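(* Assume there exists $M>0$ such that $f_0(u)\le M$ for all $u\in\mathbb R$. Then under the dyadic policy, $$\lim_{N\to\infty}\frac{H(p_N)}{N}=-H\left(\mathrm{Bin}\left(k,\tfrac12\right)\right)\quad\text{almost surely},$$ and, as $N\to\infty$, $$\frac{H(p_N)+N\,H\left(\mathrm{Bin}\left(k,\frac12\right)\right)}{\sqrt N}$$ converges in distribution to the normal distribution $\mathcal N(0,\sigma^2)$, where $\sigma^2$ is the variance of the random variable $\log\binom{k}{X}$ with $X\sim\mathrm{Bin}\left(k,\frac12\right)$.
   Context: $\log$ is the logarithm to base 2. Let $k\ge1$ be an integer. $\theta=(\theta_1,\dots,\theta_k)$ is a random vector in $\mathbb R^k$ whose coordinates are i.i.d. with Lebesgue density $f_0$ on $\mathbb R$; its density is $p_0(u)=\prod_{i=1}^k f_0(u_i)$, and its differential entropy $H(p_0)$ is assumed finite, where for a density $p$ on $\mathbb R^k$, $H(p)=-\int_{\mathbb R^k}p(u)\log p(u)\,du$. Dyadic policy: let $F_0$ be the cumulative distribution function of $f_0$, $Q(p)=\inf\{u\in\mathbb R:p\le F_0(u)\}$ for $p\in[0,1]$ (possibly $\pm\infty$ at $p=0,1$), $\mathrm{supp}(f_0)=\{u:f_0(u)>0\}$, and for each $n\ge1$ let $A_n=\left(\bigcup_{j=1}^{2^{n-1}}\left(Q\left(\frac{2j-1}{2^n}\right),Q\left(\frac{2j}{2^n}\right)\right]\right)\cap\mathrm{supp}(f_0)$. The answer to the $n$-th question is $X_n=\sum_{i=1}^k\mathbb 1_{A_n}(\theta_i)$.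 The posterior $p_n$ is the conditional density of $\theta$ given $X_1,\dots,X_n$: $p_n(u)$ is proportional to $p_0(u)$ on $\{u\in\mathbb R^k:\sum_{i=1}^k\mathbb 1_{A_m}(u_i)=X_m,\ 1\le m\le n\}$ and $0$ outside; hence $H(p_n)$ is a random variable. $H(\mathrm{Bin}(k,\frac12))$ is the discrete (Shannon, base 2) entropy of the Binomial distribution. When $\sigma^2=0$, $\mathcal N(0,0)$ is the point mass at $0$. *)

theory Defs
  imports "HOL-Probability.Probability"
begin

text \<open>Vectors of length \<open>k\<close> are elements of \<open>real ^ 'k\<close> with \<open>CARD('k) = k\<close>; densities on
  that space are taken with respect to \<open>lborel\<close>.\<close>

definition diff_entropy :: "((real ^ 'k) \<Rightarrow> real) \<Rightarrow> real" where
  "diff_entropy p = - (LINT u|lborel. p u * log 2 (p u))"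

text \<open>Since \<open>log 2 0 = 0\<close>, the integrand is \<open>0\<close> wherever \<open>p\<close> vanishes. The Bochner integral is
  also \<open>0\<close> when the integrand is not integrable, so finiteness is a separate condition.\<close>

definition finite_diff_entropy :: "((real ^ 'k) \<Rightarrow> real) \<Rightarrow> bool" where
  "finite_diff_entropy p \<longleftrightarrow> integrable lborel (\<lambda>u. p u * log 2 (p u))"

text \<open>Only meant for distributions with finite support.\<close>

definition shannon_entropy :: "'b pmf \<Rightarrow> real" where
  "shannon_entropy q = - (\<Sum>x\<in>set_pmf q. pmf q x * log 2 (pmf q x))"

definition prior :: "(real \<Rightarrow> real) \<Rightarrow> real ^ 'k \<Rightarrow> real" where
  "prior f0 u = (\<Prod>i\<in>UNIV. f0 (u $ i))"

text \<open>The infimum is taken in \<open>ereal\<close>, so it is \<open>-\<infinity>\<close> for \<open>p = 0\<close>, and \<open>\<infinity>\<close> for \<open>p = 1\<close> if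
  the distribution function never reaches \<open>1\<close>.\<close>

definition quantile :: "(real \<Rightarrow> real) \<Rightarrow> real \<Rightarrow> ereal" where
  "quantile f0 p = Inf {ereal u | u. p \<le> cdf (density lborel (\<lambda>x. ennreal (f0 x))) u}"

definition dyadic_set :: "(real \<Rightarrow> real) \<Rightarrow> nat \<Rightarrow> real set" where
  "dyadic_set f0 n =
     (\<Union>j\<in>{1..2 ^ (n - 1)}. {u. quantile f0 ((2 * real j - 1) / 2 ^ n) < ereal u \<and>
                                ereal u \<le> quantile f0 (2 * real j / 2 ^ n)})
     \<inter> {u. f0 u > 0}"

definition answer :: "(real \<Rightarrow> real) \<Rightarrow> nat \<Rightarrow> real ^ 'k \<Rightarrow> nat" where
  "answer f0 n u = (\<Sum>i\<in>UNIV. indicator (dyadic_set f0 n) (u $ i))"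

definition consistent_set :: "(real \<Rightarrow> real) \<Rightarrow> nat \<Rightarrow> (nat \<Rightarrow> nat) \<Rightarrow> (real ^ 'k) set" where
  "consistent_set f0 n x = {u. \<forall>m\<in>{1..n}. answer f0 m u = x m}"

text \<open>The normalising constant is the probability of the observed answers \<open>x 1, \<dots>, x n\<close>, so it
  vanishes only on a null event.\<close>

definition posterior :: "(real \<Rightarrow> real) \<Rightarrow> nat \<Rightarrow> (nat \<Rightarrow> nat) \<Rightarrow> real ^ 'k \<Rightarrow> real" where
  "posterior f0 n x u =
     indicator (consistent_set f0 n x) u * prior f0 u /
     (LINT v|lborel. indicator (consistent_set f0 n x) v * prior f0 (v :: real ^ 'k))"

definition posterior_entropy :: "(real \<Rightarrow> real) \<Rightarrow> nat \<Rightarrow> real ^ 'k \<Rightarrow> real" where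
  "posterior_entropy f0 n t = diff_entropy (posterior f0 n (\<lambda>m. answer f0 m t) :: real ^ 'k \<Rightarrow> real)"

text \<open>The second argument is the variance, not the standard deviation that \<open>normal_density\<close>
  takes.\<close>

definition normal_distribution :: "real \<Rightarrow> real \<Rightarrow> real measure" where
  "normal_distribution \<mu> v =
     (if v = 0 then return borel \<mu> else density lborel (\<lambda>x. ennreal (normal_density \<mu> (sqrt v) x)))"

end

theory Submission
  imports Defs
begin

text \<open>
  Applying the cumulative distribution function \<open>F\<^sub>0\<close> to the coordinates of \<open>\<theta>\<close> gives
  independent uniform variables, and the \<open>n\<close>-th question asks how many of them have \<open>n\<close>-th
  binary digit \<open>1\<close>. Hence the answers are i.i.d. with distribution \<open>Bin(k, 1/2)\<close>, and
  \<open>H(p\<^sub>N) = (\<Sum>n\<le>N. log P(X\<^sub>n)) - R\<^sub>N\<close>, where \<open>P\<close> is the binomial mass function and \<open>R\<^sub>N\<close> is the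
  conditional expectation of \<open>log p\<^sub>0(\<theta>)\<close> given the first \<open>N\<close> answers. Since \<open>log p\<^sub>0(\<theta>)\<close> is
  integrable, \<open>\<bar>R\<^sub>N\<bar>\<close> is dominated by a nonnegative martingale, so it is almost surely bounded by the
  maximal inequality and disappears after division by \<open>N\<close> or \<open>\<surd>N\<close>. The sum is treated by the
  strong law of large numbers and the central limit theorem.
\<close>

section \<open>Binary digits of the distribution function\<close>

text \<open>Prescribing \<open>n\<close> binary digits singles out one dyadic interval, encoded by
  the integer \<open>w\<close>. In the induction, halving turns
  \<open>\<lfloor>2 ^ Suc n * v\<rfloor>\<close> into \<open>\<lfloor>2 ^ n * v\<rfloor>\<close>,
  and the parity lost in halving is the new digit.\<close>

lemma dyadic_digits_eq_floor:
  fixes b :: "nat \<Rightarrow> bool"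
  shows "\<exists>w. 0 \<le> w \<and> w < 2 ^ n \<and>
    (\<forall>v::real. 0 \<le> v \<longrightarrow> v < 1 \<longrightarrow> (\<forall>m\<in>{1..n}. odd \<lfloor>2 ^ m * v\<rfloor> = b m) \<longleftrightarrow> \<lfloor>2 ^ n * v\<rfloor> = w)"
proof (induction n)
  case 0
  have "\<lfloor>v\<rfloor> = 0" if "0 \<le> v" "v < 1" for v :: real
    using that by linarith
  then show ?case by (intro exI[of _ 0]) simp
next
  case (Suc n)
  then obtain w where w: "0 \<le> w" "w < 2 ^ n" and eq: "\<And>v::real. 0 \<le> v \<Longrightarrow> v < 1 \<Longrightarrow>
      (\<forall>m\<in>{1..n}. odd \<lfloor>2 ^ m * v\<rfloor> = b m) \<longleftrightarrow> \<lfloor>2 ^ n * v\<rfloor> = w"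
    by blast
  let ?w = "2 * w + of_bool (b (Suc n))"
  have step: "(\<forall>m\<in>{1..Suc n}. odd \<lfloor>2 ^ m * v\<rfloor> = b m) \<longleftrightarrow> \<lfloor>2 ^ Suc n * v\<rfloor> = ?w"
    if v: "0 \<le> v" "v < 1" for v :: real
  proof -
    have half: "\<lfloor>2 ^ n * v\<rfloor> = \<lfloor>2 ^ Suc n * v\<rfloor> div 2"
      using floor_divide_real_eq_div[of 2 "2 ^ Suc n * v"] by simp
    have "(\<forall>m\<in>{1..Suc n}. odd \<lfloor>2 ^ m * v\<rfloor> = b m) \<longleftrightarrow>
        \<lfloor>2 ^ Suc n * v\<rfloor> div 2 = w \<and> odd \<lfloor>2 ^ Suc n * v\<rfloor> = b (Suc n)"
      unfolding half[symmetric] eq[OF v, symmetric] by (auto simp: atLeastAtMostSuc_conv)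
    also have "\<dots> \<longleftrightarrow> \<lfloor>2 ^ Suc n * v\<rfloor> = ?w"
      by (cases "b (Suc n)") (simp_all; presburger)+
    finally show ?thesis .
  qed
  have "0 \<le> ?w" "?w < 2 ^ Suc n"
    using w by (auto simp: of_bool_def)
  with step show ?case by blast
qed

text \<open>Writing the odd floor as \<open>2 * q + 1\<close> gives \<open>j = q + 1\<close>. The
  intervals are closed on the left, whereas those in \<open>dyadic_set\<close> are closed on the
  right; the two conventions differ only at dyadic rationals.\<close>

lemma odd_floor_iff_dyadic_interval:
  fixes v :: real
  assumes "0 \<le> v" "v < 1" "n \<ge> 1"
  shows "odd \<lfloor>2 ^ n * v\<rfloor> \<longleftrightarrow>
    (\<exists>j\<in>{1..2 ^ (n - 1)}. (2 * real j - 1) / 2 ^ n \<le> v \<and> v < 2 * real j / 2 ^ n)"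
proof
  have pow: "(2::real) ^ n = 2 * 2 ^ (n - 1)"
    using \<open>n \<ge> 1\<close> by (cases n) auto
  {
    assume "odd \<lfloor>2 ^ n * v\<rfloor>"
    then obtain q where q: "\<lfloor>2 ^ n * v\<rfloor> = 2 * q + 1"
      by (elim oddE)
    have "0 \<le> \<lfloor>2 ^ n * v\<rfloor>"
      using assms by simp
    then have q0: "0 \<le> q"
      using q by presburger
    have ge: "2 * real_of_int q + 1 \<le> 2 ^ n * v" and less: "2 ^ n * v < 2 * real_of_int q + 2"
      using q by linarith+
    have "2 ^ n * v < 2 ^ n * (1::real)"
      using assms by (intro mult_strict_left_mono) auto
    then have "real_of_int q < 2 ^ (n - 1)"
      using ge pow by linarith
    then have "q < 2 ^ (n - 1)"
      by (metis of_int_less_iff of_int_numeral of_int_power)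
    then have "nat q + 1 \<in> {1..2 ^ (n - 1)}"
      using q0 by (auto simp: nat_less_iff Suc_le_eq)
    then show "\<exists>j\<in>{1..2 ^ (n - 1)}. (2 * real j - 1) / 2 ^ n \<le> v \<and> v < 2 * real j / 2 ^ n"
      using ge less q0 by (intro bexI[of _ "nat q + 1"]) (auto simp: field_simps)
  next
    assume "\<exists>j\<in>{1..2 ^ (n - 1)}. (2 * real j - 1) / 2 ^ n \<le> v \<and> v < 2 * real j / 2 ^ n"
    then obtain j :: nat where "(2 * real j - 1) / 2 ^ n \<le> v" "v < 2 * real j / 2 ^ n"
      by blast
    then have "\<lfloor>2 ^ n * v\<rfloor> = 2 * int j - 1"
      by (intro floor_unique) (auto simp: field_simps)
    then show "odd \<lfloor>2 ^ n * v\<rfloor>"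
      by simp
  }
qed

text \<open>The sublevel set is a closed ray, so its probability is the value of the cdf at its
  supremum. Taking the supremum picks the right end of any flat stretch at level
  \<open>a\<close>.\<close>

lemma (in real_distribution) prob_cdf_le:
  assumes cont: "\<And>x. isCont (cdf M) x" and a: "0 < a" "a < 1"
  shows "measure M {u. cdf M u \<le> a} = a"
proof -
  let ?S = "{u. cdf M u \<le> a}"
  have "\<forall>\<^sub>F u in at_top. a < cdf M u" "\<forall>\<^sub>F u in at_bot. cdf M u < a"
    using order_tendstoD(1)[OF cdf_lim_at_top_prob] order_tendstoD(2)[OF cdf_lim_at_bot] a by auto
  then obtain y x where y: "a < cdf M y" and x: "cdf M x < a"
    by (auto simp: eventually_at_top_linorder eventually_at_bot_linorder)
  have bdd: "bdd_above ?S"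
    using y cdf_nondecreasing by (intro bdd_aboveI[of _ y]) (smt (verit) mem_Collect_eq)
  have "closed ?S"
    by (intro closed_Collect_le continuous_at_imp_continuous_on ballI cont continuous_on_const)
  then have s: "cdf M (Sup ?S) \<le> a"
    using closed_contains_Sup[OF _ bdd] less_imp_le[OF x] by blast
  have "?S = {..Sup ?S}"
  proof (intro set_eqI iffI)
    fix u assume "u \<in> {..Sup ?S}"
    then show "u \<in> ?S"
      using cdf_nondecreasing[of u "Sup ?S"] s by auto
  qed (use cSup_upper[OF _ bdd] in auto)
  then have "measure M ?S = cdf M (Sup ?S)"
    by (simp add: cdf_def)
  also have "\<dots> = a"
  proof (rule ccontr)
    assume "cdf M (Sup ?S) \<noteq> a"
    then have less: "cdf M (Sup ?S) < a"
      using s by simp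
    \<comment> \<open>If the value at the supremum were below \<open>a\<close>, continuity would
      produce a point of level \<open>a\<close> further to the right that still belongs to the
      sublevel set.\<close>
    obtain z where "z \<le> y" "cdf M z = a" "Sup ?S \<le> z"
      using IVT[of "cdf M" "Sup ?S" a y] less y cont cdf_nondecreasing[of y "Sup ?S"] by force
    moreover have "z \<le> Sup ?S"
      using \<open>cdf M z = a\<close> by (intro cSup_upper bdd) auto
    ultimately show False
      using less by simp
  qed
  finally show ?thesis .
qed

text \<open>The probability integral transform, proved by comparing distribution functions. The
  levels outside the open unit interval are treated separately, since \<open>prob_cdf_le\<close>
  covers only those inside.\<close>

lemma (in real_distribution) distr_cdf_eq_uniform:
  assumes cont: "\<And>x. isCont (cdf M) x"
  shows "distr M borel (cdf M) = uniform_measure lborel {0..1}"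
proof (rule cdf_unique)
  have [measurable]: "cdf M \<in> borel_measurable borel"
    by (intro borel_measurable_continuous_onI continuous_at_imp_continuous_on ballI cont)
  show "real_distribution (distr M borel (cdf M))"
    by (intro real_distribution_distr) simp
  then interpret D: real_distribution "distr M borel (cdf M)" .
  show "real_distribution (uniform_measure lborel {0..1::real})"
    by (intro real_distribution.intro real_distribution_axioms.intro prob_space_uniform_measure) auto
  show "cdf (distr M borel (cdf M)) = cdf (uniform_measure lborel {0..1})"
  proof
    fix a :: real
    have u: "cdf (uniform_measure lborel {0..1}) a = measure lborel ({0..1} \<inter> {..a})"
      by (simp add: cdf_def measure_uniform_measure)
    have d: "cdf (distr M borel (cdf M)) b = measure M {u. cdf M u \<le> b}" for b
      by (subst cdf_def) (simp add: measure_distr vimage_def)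
    consider "a \<le> 0" | "0 < a" "a < 1" | "1 \<le> a" by linarith
    then show "cdf (distr M borel (cdf M)) a = cdf (uniform_measure lborel {0..1}) a"
    proof cases
      case 1
      have "cdf (distr M borel (cdf M)) a \<le> e" if "0 < e" for e
      proof -
        \<comment> \<open>The cap \<open>1/2\<close> keeps the level below 1, so that
          \<open>prob_cdf_le\<close> applies to it.\<close>
        define e' where "e' = min e (1/2)"
        have "0 < e'" "e' < 1" "e' \<le> e" "a \<le> e'"
          using that 1 by (auto simp: e'_def)
        then show ?thesis
          using D.cdf_nondecreasing[of a e'] prob_cdf_le[OF cont, of e'] d[of e'] by simp
      qed
      then have "cdf (distr M borel (cdf M)) a = 0"
        using D.cdf_nonneg[of a] field_le_epsilon[of "cdf (distr M borel (cdf M)) a" 0] by force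
      moreover have "measure lborel ({0..1} \<inter> {..a}) = 0"
      proof -
        have "{0..1} \<inter> {..a} \<subseteq> {0}" using 1 by auto
        then have "emeasure lborel ({0..1} \<inter> {..a}) \<le> emeasure lborel {0::real}"
          by (intro emeasure_mono) auto
        then show ?thesis by (simp add: measure_def del: Int_atMost)
      qed
      ultimately show ?thesis using u by simp
    next
      case 2
      have "{0..1} \<inter> {..a} = {0..a}" using 2 by auto
      then show ?thesis
        using 2 by (simp add: d u prob_cdf_le[OF cont])
    next
      case 3
      have "{0..1} \<inter> {..a} = {0..1}" "{u. cdf M u \<le> a} = UNIV"
        using 3 cdf_bounded_prob order_trans by auto
      then show ?thesis
        using 3 prob_space by (simp add: d u)
    qed
  qed
qed

text \<open>The prescribed digits confine \<open>v\<close> to one dyadic interval of length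
  \<open>1 / 2 ^ n\<close>.\<close>

lemma measure_uniform_digits:
  fixes b :: "nat \<Rightarrow> bool"
  shows "measure (uniform_measure lborel {0..1}) {v::real. \<forall>m\<in>{1..n}. odd \<lfloor>2 ^ m * v\<rfloor> = b m} = 1 / 2 ^ n"
proof -
  from dyadic_digits_eq_floor[of n b]
  obtain w where w: "0 \<le> w" "w < 2 ^ n" and eq: "\<forall>v::real. 0 \<le> v \<longrightarrow> v < 1 \<longrightarrow>
      (\<forall>m\<in>{1..n}. odd \<lfloor>2 ^ m * v\<rfloor> = b m) \<longleftrightarrow> \<lfloor>2 ^ n * v\<rfloor> = w"
    by (elim exE conjE)
  let ?D = "{v::real. \<forall>m\<in>{1..n}. odd \<lfloor>2 ^ m * v\<rfloor> = b m}" and ?I = "{w / 2 ^ n..<(w + 1) / 2 ^ n}"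
  have "real_of_int (w + 1) \<le> real_of_int (2 ^ n)"
    using w(2) by (intro of_int_le_iff[THEN iffD2]) simp
  then have wn: "real_of_int w + 1 \<le> 2 ^ n"
    by simp
  have I: "v \<in> ?I \<longleftrightarrow> \<lfloor>2 ^ n * v\<rfloor> = w" for v :: real
    by (simp add: floor_eq_iff field_simps)
  have I01: "?I \<subseteq> {0..<1}"
  proof
    fix v assume v: "v \<in> ?I"
    have "(w + 1) / 2 ^ n \<le> 1" "0 \<le> w / 2 ^ n"
      using wn w by auto
    with v show "v \<in> {0..<1}" by (auto intro: order.trans less_le_trans)
  qed
  have [measurable]: "?D \<in> sets borel"
    by measurable
  have DI: "{0..<1} \<inter> ?D = ?I"
  proof (intro set_eqI)
    fix v
    show "v \<in> {0..<1} \<inter> ?D \<longleftrightarrow> v \<in> ?I"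
      using eq[rule_format, of v] I[of v] I01 by fastforce
  qed
  \<comment> \<open>The description of digits by a floor holds on \<open>{0..<1}\<close> only; the
    endpoint 1 is discarded as a null set.\<close>
  have "AE v in lborel. v \<in> {0..1} \<inter> ?D \<longleftrightarrow> v \<in> ?I"
    using AE_lborel_singleton[of 1]
  proof eventually_elim
    case (elim v)
    then have "v \<in> {0..1} \<longleftrightarrow> v \<in> {0..<1}" by auto
    then show ?case using DI by blast
  qed
  then have "emeasure lborel ({0..1} \<inter> ?D) = emeasure lborel ?I"
    by (intro emeasure_eq_AE) auto
  then have "measure lborel ({0..1} \<inter> ?D) = 1 / 2 ^ n"
    by (simp add: measure_def field_simps)
  then show ?thesis
    by (simp add: measure_uniform_measure)
qed

text \<open>The quantile lies below \<open>u\<close> exactly when \<open>F\<close> has already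
  reached \<open>p\<close> strictly to the left of \<open>u\<close>. Left continuity gives one
  direction. The case \<open>F u = p\<close> is excluded because \<open>F\<close> may be flat to the
  left of \<open>u\<close>.\<close>

lemma quantile_less_iff:
  fixes f0
  defines "F \<equiv> cdf (density lborel (\<lambda>x. ennreal (f0 x)))"
  assumes "prob_space (density lborel (\<lambda>x. ennreal (f0 x)))"
    and cont: "isCont F u" and ne: "F u \<noteq> p"
  shows "quantile f0 p < ereal u \<longleftrightarrow> p < F u"
proof -
  interpret prob_space "density lborel (\<lambda>x. ennreal (f0 x))" by fact
  interpret real_distribution "density lborel (\<lambda>x. ennreal (f0 x))"
    by unfold_locales auto
  have "quantile f0 p < ereal u \<longleftrightarrow> (\<exists>v<u. p \<le> F v)"
    by (auto simp: quantile_def F_def Inf_less_iff)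
  also have "\<dots> \<longleftrightarrow> p < F u"
  proof
    assume "\<exists>v<u. p \<le> F v"
    then obtain v where "v \<le> u" "p \<le> F v"
      by (auto intro: less_imp_le)
    then show "p < F u"
      using ne cdf_nondecreasing[of v u] unfolding F_def by linarith
  next
    assume "p < F u"
    moreover have "(F \<longlongrightarrow> F u) (at_left u)"
      using cont by (simp add: isCont_def filterlim_at_split)
    ultimately have "\<forall>\<^sub>F v in at_left u. p < F v"
      by (intro order_tendstoD)
    then have "\<forall>\<^sub>F v in at_left u. v < u \<and> p \<le> F v"
      using eventually_at_left_real[of "u - 1" u, simplified] by eventually_elim auto
    then show "\<exists>v<u. p \<le> F v"
      using eventually_happens'[of "at_left u"] by (auto simp: trivial_limit_at_left_real)
  qed
  finally show ?thesis .
qed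

lemma dyadic_set_measurable [measurable]:
  assumes [measurable]: "f0 \<in> borel_measurable borel"
  shows "dyadic_set f0 n \<in> sets borel"
  unfolding dyadic_set_def by measurable

lemma isCont_cdf_density:
  assumes "prob_space (density lborel f)" and [measurable]: "f \<in> borel_measurable borel"
  shows "isCont (cdf (density lborel f)) x"
proof -
  interpret prob_space "density lborel f" by fact
  interpret real_distribution "density lborel f"
    by unfold_locales auto
  have "emeasure (density lborel f) {x} = 0"
    by (subst emeasure_density)
      (auto intro!: nn_integral_null_set[of "{x}", unfolded] simp: null_sets_def)
  then show ?thesis
    by (simp add: isCont_cdf measure_def)
qed

text \<open>Since \<open>cdf \<mu> u\<close> is uniform under \<open>\<mu>\<close>, it almost surely
  avoids the countable set of dyadic rationals, and off this set the quantile intervals are exactly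
  the digit intervals.\<close>

lemma AE_dyadic_set_iff_digit:
  fixes f0
  defines "\<mu> \<equiv> density lborel (\<lambda>x. ennreal (f0 x))"
  assumes "prob_space \<mu>" and [measurable]: "f0 \<in> borel_measurable borel"
  shows "AE u in \<mu>. \<forall>n\<ge>1. u \<in> dyadic_set f0 n \<longleftrightarrow> odd \<lfloor>2 ^ n * cdf \<mu> u\<rfloor>"
proof -
  interpret prob_space \<mu> by fact
  interpret real_distribution \<mu>
    by unfold_locales (auto simp: \<mu>_def)
  have cont: "isCont (cdf \<mu>) x" for x
    using assms(2) unfolding \<mu>_def by (intro isCont_cdf_density) auto
  then have [measurable]: "cdf \<mu> \<in> borel_measurable borel"
    by (intro borel_measurable_continuous_onI continuous_at_imp_continuous_on ballI)
  \<comment> \<open>All levels \<open>n\<close> are collected in one countable set, so a single null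
    set serves every question.\<close>
  let ?D = "range (\<lambda>(j::int, n::nat). real_of_int j / 2 ^ n)"
  have "AE v in lborel. v \<notin> ?D"
    by (intro AE_not_in countable_imp_null_set_lborel) auto
  then have "AE v in distr \<mu> borel (cdf \<mu>). v \<notin> ?D"
    unfolding distr_cdf_eq_uniform[OF cont] by (intro AE_uniform_measureI) auto
  then have "AE u in \<mu>. cdf \<mu> u \<notin> ?D"
    by (rule AE_distrD[rotated]) simp
  moreover have "AE u in \<mu>. 0 < f0 u"
    unfolding \<mu>_def by (subst AE_density) auto
  ultimately show ?thesis
  proof eventually_elim
    case (elim u)
    have D: "cdf \<mu> u \<noteq> real_of_int j / 2 ^ n" for j n
      using elim(1) by (force simp: image_iff)
    \<comment> \<open>The value 1 is itself a dyadic rational, namely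
      \<open>1 / 2 ^ 0\<close>.\<close>
    have less: "cdf \<mu> u < 1"
      using D[of 1 0] cdf_bounded_prob[of u] by simp
    have q: "quantile f0 (real_of_int j / 2 ^ n) < ereal u \<longleftrightarrow> real_of_int j / 2 ^ n < cdf \<mu> u" for j n
      using assms(2) cont D unfolding \<mu>_def by (intro quantile_less_iff) auto
    show ?case
    proof (intro allI impI)
      fix n :: nat assume "n \<ge> 1"
      have "quantile f0 ((2 * real j - 1) / 2 ^ n) < ereal u \<and> ereal u \<le> quantile f0 (2 * real j / 2 ^ n)
        \<longleftrightarrow> (2 * real j - 1) / 2 ^ n \<le> cdf \<mu> u \<and> cdf \<mu> u < 2 * real j / 2 ^ n" for j
        using q[of "2 * int j - 1" n] q[of "2 * int j" n] D[of "2 * int j - 1" n] D[of "2 * int j" n]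
        by (auto simp: not_less[symmetric])
      then show "u \<in> dyadic_set f0 n \<longleftrightarrow> odd \<lfloor>2 ^ n * cdf \<mu> u\<rfloor>"
        unfolding odd_floor_iff_dyadic_interval[OF cdf_nonneg less \<open>n \<ge> 1\<close>] dyadic_set_def
        using elim(2) by auto
    qed
  qed
qed

text \<open>A pattern of memberships amounts to prescribing \<open>n\<close> binary digits of the
  uniform variable \<open>cdf \<mu> u\<close>.\<close>

lemma measure_dyadic_pattern:
  fixes f0 and b :: "nat \<Rightarrow> bool"
  defines "\<mu> \<equiv> density lborel (\<lambda>x. ennreal (f0 x))"
  assumes "prob_space \<mu>" and [measurable]: "f0 \<in> borel_measurable borel"
  shows "measure \<mu> {u. \<forall>m\<in>{1..n}. u \<in> dyadic_set f0 m \<longleftrightarrow> b m} = 1 / 2 ^ n"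
proof -
  interpret prob_space \<mu> by fact
  interpret real_distribution \<mu>
    by unfold_locales (auto simp: \<mu>_def)
  have cont: "isCont (cdf \<mu>) x" for x
    using assms(2) unfolding \<mu>_def by (intro isCont_cdf_density) auto
  then have [measurable]: "cdf \<mu> \<in> borel_measurable borel"
    by (intro borel_measurable_continuous_onI continuous_at_imp_continuous_on ballI)
  have "measure \<mu> {u. \<forall>m\<in>{1..n}. u \<in> dyadic_set f0 m \<longleftrightarrow> b m}
      = measure \<mu> {u. \<forall>m\<in>{1..n}. odd \<lfloor>2 ^ m * cdf \<mu> u\<rfloor> = b m}"
    using AE_dyadic_set_iff_digit[OF assms(2)[unfolded \<mu>_def]] unfolding \<mu>_def[symmetric]
    by (intro measure_eq_AE) auto
  also have "\<dots> = measure (distr \<mu> borel (cdf \<mu>)) {v. \<forall>m\<in>{1..n}. odd \<lfloor>2 ^ m * v\<rfloor> = b m}"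
    by (subst measure_distr) (auto simp: vimage_def)
  also have "\<dots> = 1 / 2 ^ n"
    unfolding distr_cdf_eq_uniform[OF cont] by (rule measure_uniform_digits)
  finally show ?thesis .
qed

section \<open>The law of a vector with independent coordinates\<close>

lemma bij_betw_axis_Basis: "bij_betw (\<lambda>i. axis i 1) UNIV (Basis :: (real ^ 'k) set)"
  by (auto simp: bij_betw_def inj_on_def axis_eq_axis Basis_vec_def)

text \<open>Tonelli's theorem is available for the coordinates \<open>x \<bullet> b\<close> with
  \<open>b\<close> in \<open>Basis\<close>; the bijection \<open>i \<mapsto> axis i 1\<close>
  carries it over to the coordinates \<open>x $ i\<close>.\<close>

lemma nn_integral_lborel_vec_prod:
  fixes g :: "'k::finite \<Rightarrow> real \<Rightarrow> ennreal"
  assumes [measurable]: "\<And>i. g i \<in> borel_measurable borel"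
  shows "(\<integral>\<^sup>+x. (\<Prod>i\<in>UNIV. g i (x $ i)) \<partial>(lborel :: (real ^ 'k) measure)) = (\<Prod>i\<in>UNIV. \<integral>\<^sup>+x. g i x \<partial>lborel)"
proof -
  let ?inv = "the_inv_into UNIV (\<lambda>i. axis i 1 :: real ^ 'k)"
  have inv: "?inv (axis i 1) = i" for i
    using bij_betw_axis_Basis by (intro the_inv_into_f_f) (auto simp: bij_betw_def)
  have "(\<integral>\<^sup>+x. (\<Prod>b\<in>Basis. g (?inv b) (x \<bullet> b)) \<partial>(lborel :: (real ^ 'k) measure))
      = (\<Prod>b\<in>Basis. \<integral>\<^sup>+x. g (?inv b) x \<partial>lborel)"
    by (intro nn_integral_lborel_prod) auto
  then show ?thesis
    unfolding prod.reindex_bij_betw[OF bij_betw_axis_Basis, symmetric] inv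
    by (simp add: inner_axis)
qed

lemma prior_nonneg: "(\<And>u. 0 \<le> f0 u) \<Longrightarrow> 0 \<le> prior f0 u"
  unfolding prior_def by (intro prod_nonneg) auto

lemma prior_measurable [measurable]:
  assumes [measurable]: "f0 \<in> borel_measurable borel"
  shows "prior f0 \<in> borel_measurable borel"
  unfolding prior_def by measurable

lemma (in prob_space) prob_vec_rectangle:
  fixes \<theta> :: "'a \<Rightarrow> real ^ 'k"
  assumes "indep_vars (\<lambda>_. borel) (\<lambda>i \<omega>. \<theta> \<omega> $ i) UNIV"
    and "\<And>i. E i \<in> sets borel"
  shows "prob {\<omega> \<in> space M. \<forall>i. \<theta> \<omega> $ i \<in> E i} = (\<Prod>i\<in>UNIV. prob {\<omega> \<in> space M. \<theta> \<omega> $ i \<in> E i})"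
proof -
  have "prob (\<Inter>i\<in>UNIV. (\<lambda>\<omega>. \<theta> \<omega> $ i) -` E i \<inter> space M)
      = (\<Prod>i\<in>UNIV. prob ((\<lambda>\<omega>. \<theta> \<omega> $ i) -` E i \<inter> space M))"
    using assms unfolding indep_vars_def2 by (intro indep_setsD[of _ UNIV]) auto
  moreover have "(\<Inter>i\<in>UNIV. (\<lambda>\<omega>. \<theta> \<omega> $ i) -` E i \<inter> space M) = {\<omega> \<in> space M. \<forall>i. \<theta> \<omega> $ i \<in> E i}"
    by auto
  moreover have "(\<lambda>\<omega>. \<theta> \<omega> $ i) -` E i \<inter> space M = {\<omega> \<in> space M. \<theta> \<omega> $ i \<in> E i}" for i
    by auto
  ultimately show ?thesis
    by simp
qed

text \<open>Open boxes form an intersection-stable generator. On a box, independence factorises the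
  left measure and Tonelli's theorem the right one.\<close>

lemma (in prob_space) distr_vec_eq_prior:
  fixes \<theta> :: "'a \<Rightarrow> real ^ 'k"
  assumes f0: "\<And>u. 0 \<le> f0 u" and [measurable]: "f0 \<in> borel_measurable borel"
    and indep: "indep_vars (\<lambda>_. borel) (\<lambda>i \<omega>. \<theta> \<omega> $ i) UNIV"
    and D: "\<And>i. distributed M lborel (\<lambda>\<omega>. \<theta> \<omega> $ i) (\<lambda>u. ennreal (f0 u))"
    and [measurable]: "\<theta> \<in> borel_measurable M"
  shows "distr M borel \<theta> = density lborel (\<lambda>u. ennreal (prior f0 u))"
proof (rule measure_eqI_generator_eq)
  let ?E = "range (\<lambda>(a, b). box a b :: (real ^ 'k) set)"
  show "Int_stable ?E"
    by (auto simp: Int_stable_def box_Int_box)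
  show "?E \<subseteq> Pow UNIV" "sets (distr M borel \<theta>) = sigma_sets UNIV ?E"
    "sets (density lborel (\<lambda>u. ennreal (prior f0 u))) = sigma_sets UNIV ?E"
    by (simp_all add: borel_eq_box)
  let ?A = "\<lambda>n::nat. box (- (real n *\<^sub>R One)) (real n *\<^sub>R One) :: (real ^ 'k) set"
  show "range ?A \<subseteq> ?E" "(\<Union>i. ?A i) = UNIV"
    unfolding UN_box_eq_UNIV by auto
  show "emeasure (distr M borel \<theta>) (?A i) \<noteq> \<infinity>" for i
    by (simp add: emeasure_distr)
  fix X assume "X \<in> ?E"
  then obtain l r where X: "X = box l r" by auto
  have box: "x \<in> X \<longleftrightarrow> (\<forall>i. x $ i \<in> {l $ i<..<r $ i})" for x
    by (auto simp: X mem_box_cart)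
  have "emeasure (distr M borel \<theta>) X = ennreal (prob {\<omega> \<in> space M. \<forall>i. \<theta> \<omega> $ i \<in> {l $ i<..<r $ i}})"
    unfolding X by (subst emeasure_distr)
      (auto simp: emeasure_eq_measure vimage_def box[unfolded X] Int_def conj_commute)
  also have "\<dots> = (\<Prod>i\<in>UNIV. emeasure M {\<omega> \<in> space M. \<theta> \<omega> $ i \<in> {l $ i<..<r $ i}})"
    by (subst prob_vec_rectangle[OF indep]) (auto simp: prod_ennreal emeasure_eq_measure)
  also have "\<dots> = (\<Prod>i\<in>UNIV. \<integral>\<^sup>+x. ennreal (f0 x) * indicator {l $ i<..<r $ i} x \<partial>lborel)"
  proof (intro prod.cong refl)
    fix i
    have "{\<omega> \<in> space M. \<theta> \<omega> $ i \<in> {l $ i<..<r $ i}} = (\<lambda>\<omega>. \<theta> \<omega> $ i) -` {l $ i<..<r $ i} \<inter> space M"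
      by auto
    then show "emeasure M {\<omega> \<in> space M. \<theta> \<omega> $ i \<in> {l $ i<..<r $ i}}
        = (\<integral>\<^sup>+x. ennreal (f0 x) * indicator {l $ i<..<r $ i} x \<partial>lborel)"
      using distributed_emeasure[OF D] by simp
  qed
  also have "\<dots> = (\<integral>\<^sup>+x. (\<Prod>i\<in>UNIV. ennreal (f0 (x $ i)) * indicator {l $ i<..<r $ i} (x $ i)) \<partial>lborel)"
    by (subst nn_integral_lborel_vec_prod) auto
  also have "\<dots> = (\<integral>\<^sup>+x. ennreal (prior f0 x) * indicator X x \<partial>lborel)"
  proof (rule nn_integral_cong)
    fix x :: "real ^ 'k"
    have "(\<Prod>i\<in>UNIV. indicator {l $ i<..<r $ i} (x $ i)) = (indicator X x :: ennreal)"
    proof (cases "x \<in> X")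
      case False
      then have "\<exists>i. indicator {l $ i<..<r $ i} (x $ i) = (0 :: ennreal)"
        using box[of x] by (metis indicator_simps(2))
      with False show ?thesis
        by (subst prod_zero) auto
    qed (use box[of x] in auto)
    then show "(\<Prod>i\<in>UNIV. ennreal (f0 (x $ i)) * indicator {l $ i<..<r $ i} (x $ i)) = ennreal (prior f0 x) * indicator X x"
      using f0 by (simp add: prod.distrib prior_def prod_ennreal)
  qed
  also have "\<dots> = emeasure (density lborel (\<lambda>u. ennreal (prior f0 u))) X"
    by (subst emeasure_density) (auto simp: X)
  finally show "emeasure (distr M borel \<theta>) X = emeasure (density lborel (\<lambda>u. ennreal (prior f0 u))) X" .
qed

section \<open>Limit theorems\<close>

text \<open>The joint mass functions of initial segments suffice: summing them over products of sets
  gives the probabilities of all finite-dimensional rectangles, hence both independence and the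
  marginal laws.\<close>

lemma (in prob_space) indep_vars_discreteI:
  fixes X :: "nat \<Rightarrow> 'a \<Rightarrow> 'b" and p :: "'b pmf"
  assumes fin: "finite (set_pmf p)"
    and X[measurable]: "\<And>n. X n \<in> M \<rightarrow>\<^sub>M count_space UNIV"
    and range: "\<And>n \<omega>. \<omega> \<in> space M \<Longrightarrow> X n \<omega> \<in> set_pmf p"
    and prefix: "\<And>n x. prob {\<omega> \<in> space M. \<forall>m<n. X m \<omega> = x m} = (\<Prod>m<n. pmf p (x m))"
  shows "indep_vars (\<lambda>_. count_space UNIV) X UNIV"
    and "distr M (count_space UNIV) (X n) = measure_pmf p"
proof -
  have sets: "prob {\<omega> \<in> space M. \<forall>m<n. X m \<omega> \<in> A m} = (\<Prod>m<n. measure p (A m))" for n A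
  proof -
    \<comment> \<open>Extensional functions are used so that distinct elements differ at some index
      below \<open>n\<close>, which makes the events disjoint.\<close>
    let ?P = "PiE {..<n} (\<lambda>m. A m \<inter> set_pmf p)"
    have finP: "finite ?P"
      using fin by (intro finite_PiE) auto
    have disj: "disjoint_family_on (\<lambda>x. {\<omega> \<in> space M. \<forall>m<n. X m \<omega> = x m}) ?P"
    proof (unfold disjoint_family_on_def, intro ballI impI)
      fix x y assume xy: "x \<in> ?P" "y \<in> ?P" "x \<noteq> y"
      then obtain m where "m \<in> {..<n}" "x m \<noteq> y m"
        using PiE_ext[of x _ _ y] by blast
      then show "{\<omega> \<in> space M. \<forall>m<n. X m \<omega> = x m} \<inter> {\<omega> \<in> space M. \<forall>m<n. X m \<omega> = y m} = {}"
        by auto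
    qed
    have "{\<omega> \<in> space M. \<forall>m<n. X m \<omega> \<in> A m} = (\<Union>x\<in>?P. {\<omega> \<in> space M. \<forall>m<n. X m \<omega> = x m})"
      (is "?L = ?R")
    proof (intro set_eqI iffI)
      fix \<omega> assume "\<omega> \<in> ?L"
      then show "\<omega> \<in> ?R"
        using range by (intro UN_I[of "\<lambda>m\<in>{..<n}. X m \<omega>"]) auto
    qed (fastforce simp: PiE_iff)
    then have "prob ?L = (\<Sum>x\<in>?P. prob {\<omega> \<in> space M. \<forall>m<n. X m \<omega> = x m})"
      using finP disj by (simp only:, intro finite_measure_finite_Union) auto
    also have "\<dots> = (\<Sum>x\<in>?P. \<Prod>m<n. pmf p (x m))"
      by (simp only: prefix)
    also have "\<dots> = (\<Prod>m<n. \<Sum>y\<in>A m \<inter> set_pmf p. pmf p y)"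
      using fin by (intro prod_sum_PiE[symmetric]) auto
    also have "\<dots> = (\<Prod>m<n. measure p (A m))"
      using fin by (intro prod.cong refl)
        (simp add: measure_measure_pmf_finite[symmetric] measure_Int_set_pmf)
    finally show ?thesis .
  qed
  have sub: "prob {\<omega> \<in> space M. \<forall>j\<in>J. X j \<omega> \<in> A j} = (\<Prod>j\<in>J. measure p (A j))" if "finite J" for J A
  proof -
    obtain n where n: "J \<subseteq> {..<n}"
      using \<open>finite J\<close> finite_nat_iff_bounded[of J] by blast
    \<comment> \<open>Indices outside \<open>J\<close> are left unconstrained; their factors equal
      1.\<close>
    let ?A = "\<lambda>m. if m \<in> J then A m else UNIV"
    have "{\<omega> \<in> space M. \<forall>j\<in>J. X j \<omega> \<in> A j} = {\<omega> \<in> space M. \<forall>m<n. X m \<omega> \<in> ?A m}"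
      using n by auto
    then have "prob {\<omega> \<in> space M. \<forall>j\<in>J. X j \<omega> \<in> A j} = (\<Prod>m<n. measure p (?A m))"
      by (simp only: sets)
    also have "\<dots> = (\<Prod>j\<in>J. measure p (A j))"
      using n by (intro prod.mono_neutral_cong_right) auto
    finally show ?thesis .
  qed
  have single: "prob {\<omega> \<in> space M. X j \<omega> \<in> A} = measure p A" for j A
    using sub[of "{j}" "\<lambda>_. A"] by simp
  have vim: "X j -` A \<inter> space M = {\<omega> \<in> space M. X j \<omega> \<in> A}" for j A
    by auto
  show "indep_vars (\<lambda>_. count_space UNIV) X UNIV"
    unfolding indep_vars_def2
  proof (intro conjI ballI indep_setsI)
    fix A J
    assume J: "J \<noteq> {}" "J \<subseteq> (UNIV :: nat set)" "finite J"
      and "\<forall>j\<in>J. A j \<in> {X j -` B \<inter> space M |B. B \<in> sets (count_space UNIV)}"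
    then have "\<forall>j\<in>J. \<exists>B. A j = {\<omega> \<in> space M. X j \<omega> \<in> B}"
      unfolding vim by blast
    then obtain B where B: "\<And>j. j \<in> J \<Longrightarrow> A j = {\<omega> \<in> space M. X j \<omega> \<in> B j}"
      by metis
    have "(\<Inter>j\<in>J. A j) = {\<omega> \<in> space M. \<forall>j\<in>J. X j \<omega> \<in> B j}"
      using B J by auto
    then show "prob (\<Inter>j\<in>J. A j) = (\<Prod>j\<in>J. prob (A j))"
      using B J by (simp add: sub single cong: prod.cong)
  qed (use measurable_sets[OF X] in auto)
  show "distr M (count_space UNIV) (X n) = measure_pmf p"
  proof (rule measure_eqI)
    fix A
    show "emeasure (distr M (count_space UNIV) (X n)) A = emeasure (measure_pmf p) A"
      by (simp add: emeasure_distr vim emeasure_eq_measure single measure_pmf.emeasure_eq_measure)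
  qed simp
qed

text \<open>Hoeffding's inequality makes the probability of a deviation by \<open>e\<close> decay
  geometrically in \<open>n\<close>. Borel-Cantelli applied to the tolerances
  \<open>1 / Suc k\<close> then gives almost sure convergence.\<close>

lemma (in prob_space) bounded_iid_average_AE:
  fixes X :: "nat \<Rightarrow> 'a \<Rightarrow> real"
  assumes indep: "indep_vars (\<lambda>_. borel) X UNIV"
    and bound: "\<And>n. AE \<omega> in M. \<bar>X n \<omega>\<bar> \<le> B"
    and mean: "\<And>n. expectation (X n) = m"
  shows "AE \<omega> in M. (\<lambda>n. (\<Sum>i<n. X i \<omega>) / real n) \<longlonglongrightarrow> m"
proof -
  \<comment> \<open>The maximum with 1 makes the bound positive, so the intervals
    \<open>{- b..b}\<close> have positive width.\<close>
  define b where "b = max B 1"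
  have b: "b > 0" by (simp add: b_def)
  have [measurable]: "X i \<in> borel_measurable M" for i
    using indep unfolding indep_vars_def2 by auto
  define A where "A e n = {\<omega> \<in> space M. \<bar>(\<Sum>i<n. X i \<omega>) - real n * m\<bar> \<ge> e * real n}" for e n
  have ev: "AE \<omega> in M. eventually (\<lambda>n. \<omega> \<in> space M - A e n) sequentially" if e: "e > 0" for e
  proof (rule borel_cantelli_AE1)
    show "A e n \<in> sets M" for n
      unfolding A_def by measurable
    show "emeasure M (A e n) < \<infinity>" for n
      by (simp add: emeasure_eq_measure)
    \<comment> \<open>With widths \<open>2 * b\<close> the Hoeffding exponent
      \<open>- 2 * (e * n)\<^sup>2 / (4 * n * b\<^sup>2)\<close> equals \<open>n\<close> times the
      logarithm of \<open>q\<close>.\<close>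
    define q where "q = exp (- (e\<^sup>2 / (2 * b\<^sup>2)))"
    have "q < 1"
      using e b by (simp add: q_def)
    have "prob (A e n) \<le> 2 * q ^ n" if "n \<ge> 1" for n
    proof -
      interpret H: Hoeffding_ineq M "{..<n}" X "\<lambda>_. - b" "\<lambda>_. b" "real n * m"
      proof unfold_locales
        show "indep_vars (\<lambda>_. borel) X {..<n}"
          using indep by (rule indep_vars_subset) auto
        show "AE \<omega> in M. X i \<omega> \<in> {- b..b}" for i
          using bound[of i] by eventually_elim (auto simp: b_def)
      qed (auto simp: mean)
      have "prob (A e n) \<le> 2 * exp (- 2 * (e * real n)\<^sup>2 / (\<Sum>i<n. (b - - b)\<^sup>2))"
        unfolding A_def using e b that by (intro H.Hoeffding_ineq_abs_ge) auto
      also have "- 2 * (e * real n)\<^sup>2 / (\<Sum>i<n. (b - - b)\<^sup>2) = real n * (- (e\<^sup>2 / (2 * b\<^sup>2)))"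
        using b that by (simp add: field_simps power2_eq_square)
      finally show ?thesis
        by (simp add: q_def exp_of_nat_mult[symmetric])
    qed
    then have "\<forall>\<^sub>F n in sequentially. norm (prob (A e n)) \<le> 2 * q ^ n"
      by (intro eventually_at_top_linorderI[of 1]) simp
    moreover have "summable (\<lambda>n. 2 * q ^ n)"
      using \<open>q < 1\<close> by (intro summable_mult summable_geometric) (simp add: q_def)
    ultimately show "summable (\<lambda>n. prob (A e n))"
      by (rule summable_comparison_test_ev)
  qed
  have "AE \<omega> in M. \<forall>k. eventually (\<lambda>n. \<omega> \<in> space M - A (1 / Suc k) n) sequentially"
    by (intro AE_all_countable[THEN iffD2] allI ev) simp
  then show ?thesis
  proof (rule AE_mp, intro AE_I2 impI)
    fix \<omega> assume "\<omega> \<in> space M" and \<omega>: "\<forall>k. eventually (\<lambda>n. \<omega> \<in> space M - A (1 / Suc k) n) sequentially"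
    show "(\<lambda>n. (\<Sum>i<n. X i \<omega>) / real n) \<longlonglongrightarrow> m"
    proof (rule tendstoI)
      fix r :: real assume "r > 0"
      then obtain k where k: "1 / real (Suc k) < r"
        using nat_approx_posE by auto
      show "\<forall>\<^sub>F n in sequentially. dist ((\<Sum>i<n. X i \<omega>) / real n) m < r"
        using \<omega>[rule_format, of k] eventually_gt_at_top[of 0]
      proof eventually_elim
        case (elim n)
        then have "\<bar>(\<Sum>i<n. X i \<omega>) - real n * m\<bar> < 1 / Suc k * real n"
          using \<open>\<omega> \<in> space M\<close> by (auto simp: A_def)
        also have "\<dots> < r * real n"
          using k elim by (intro mult_strict_right_mono) auto
        finally have "\<bar>(\<Sum>i<n. X i \<omega>) - real n * m\<bar> / real n < r"
          using elim by (simp add: field_simps)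
        moreover have "(\<Sum>i<n. X i \<omega>) / real n - m = ((\<Sum>i<n. X i \<omega>) - real n * m) / real n"
          using elim by (simp add: diff_divide_distrib)
        ultimately show ?case by (simp add: dist_real_def)
      qed
    qed
  qed
qed

text \<open>Slutsky's theorem, by comparing characteristic functions.\<close>

lemma (in prob_space) weak_conv_add_AE_null:
  fixes Z W :: "nat \<Rightarrow> 'a \<Rightarrow> real"
  assumes [measurable]: "\<And>n. Z n \<in> borel_measurable M" "\<And>n. W n \<in> borel_measurable M"
    and L: "real_distribution L" and Z: "weak_conv_m (\<lambda>n. distr M borel (Z n)) L"
    and W: "AE \<omega> in M. (\<lambda>n. W n \<omega>) \<longlonglongrightarrow> 0"
  shows "weak_conv_m (\<lambda>n. distr M borel (\<lambda>\<omega>. Z n \<omega> + W n \<omega>)) L"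
proof (rule levy_continuity)
  fix t
  \<comment> \<open>This expectation dominates the distance between the two characteristic functions
    at \<open>t\<close>, because \<open>iexp (t * Z n \<omega>)\<close> has modulus 1.\<close>
  have "(\<lambda>n. LINT \<omega>|M. norm (iexp (t * W n \<omega>) - 1)) \<longlonglongrightarrow> (LINT \<omega>|M. 0)"
  proof (rule integral_dominated_convergence[where w = "\<lambda>_. 2"])
    show "AE \<omega> in M. (\<lambda>n. norm (iexp (t * W n \<omega>) - 1)) \<longlonglongrightarrow> 0"
      using W
    proof eventually_elim
      case (elim \<omega>)
      have "(\<lambda>n. norm (iexp (t * W n \<omega>) - 1)) \<longlonglongrightarrow> norm (iexp (t * 0) - 1)"
        by (intro tendsto_intros elim)
      then show ?case by simp
    qed
    show "AE \<omega> in M. norm (norm (iexp (t * W n \<omega>) - 1)) \<le> 2" for n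
    proof (rule AE_I2)
      fix \<omega>
      show "norm (norm (iexp (t * W n \<omega>) - 1)) \<le> 2"
        using norm_triangle_ineq4[of "iexp (t * W n \<omega>)" 1] by simp
    qed
  qed auto
  then have lim: "(\<lambda>n. LINT \<omega>|M. norm (iexp (t * W n \<omega>) - 1)) \<longlonglongrightarrow> 0"
    by simp
  have "norm (char (distr M borel (\<lambda>\<omega>. Z n \<omega> + W n \<omega>)) t - char (distr M borel (Z n)) t)
      \<le> (LINT \<omega>|M. norm (iexp (t * W n \<omega>) - 1))" for n
  proof -
    have "char (distr M borel (\<lambda>\<omega>. Z n \<omega> + W n \<omega>)) t - char (distr M borel (Z n)) t
        = (LINT \<omega>|M. iexp (t * (Z n \<omega> + W n \<omega>)) - iexp (t * Z n \<omega>))"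
      unfolding char_def by (simp add: integral_distr integrable_iexp Bochner_Integration.integral_diff)
    also have "\<dots> = (LINT \<omega>|M. iexp (t * Z n \<omega>) * (iexp (t * W n \<omega>) - 1))"
      by (simp add: algebra_simps exp_add)
    finally show ?thesis
      using integral_norm_bound[of M "\<lambda>\<omega>. iexp (t * Z n \<omega>) * (iexp (t * W n \<omega>) - 1)"]
      by (simp add: norm_mult)
  qed
  then have diff: "(\<lambda>n. char (distr M borel (\<lambda>\<omega>. Z n \<omega> + W n \<omega>)) t - char (distr M borel (Z n)) t) \<longlonglongrightarrow> 0"
    by (intro Lim_null_comparison[OF _ lim] always_eventually allI)
  have Z': "(\<lambda>n. char (distr M borel (Z n)) t) \<longlonglongrightarrow> char L t"
    using L Z by (intro levy_continuity1) auto
  show "(\<lambda>n. char (distr M borel (\<lambda>\<omega>. Z n \<omega> + W n \<omega>)) t) \<longlonglongrightarrow> char L t"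
    using tendsto_add[OF diff Z'] by simp
qed (use L in auto)

text \<open>Scaling by \<open>a\<close> replaces the argument \<open>t\<close> of the characteristic
  function by \<open>t * a\<close>, so Levy continuity transfers the convergence.\<close>

lemma weak_conv_m_scale:
  assumes M: "\<And>n. real_distribution (M n)" and L: "real_distribution L" and lim: "weak_conv_m M L"
  shows "weak_conv_m (\<lambda>n. distr (M n) borel ((*) a)) (distr L borel ((*) a))"
proof (rule levy_continuity)
  have dist: "real_distribution (distr N borel ((*) a))" if "real_distribution N" for N
  proof -
    interpret N: real_distribution N by fact
    show ?thesis
      by (intro N.real_distribution_distr) simp
  qed
  show "real_distribution (distr (M n) borel ((*) a))" "real_distribution (distr L borel ((*) a))" for n
    using dist M L by auto
  have char: "char (distr N borel ((*) a)) t = char N (t * a)" if "real_distribution N" for N t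
  proof -
    interpret N: real_distribution N by fact
    show ?thesis
      by (simp add: char_def integral_distr mult.assoc)
  qed
  show "(\<lambda>n. char (distr (M n) borel ((*) a)) t) \<longlonglongrightarrow> char (distr L borel ((*) a)) t" for t
    unfolding char[OF M] char[OF L] by (rule levy_continuity1[OF M L lim])
qed

lemma distr_std_normal_scale:
  assumes "0 < \<sigma>"
  shows "distr std_normal_distribution borel ((*) \<sigma>) = density lborel (normal_density 0 \<sigma>)"
proof -
  interpret N: prob_space std_normal_distribution
    by (rule prob_space_normal_density) simp
  have "distributed std_normal_distribution lborel (\<lambda>x. x) std_normal_density"
    by (auto simp: distributed_def distr_id2)
  from N.normal_density_affine[OF this _ less_imp_neq[OF assms, symmetric], of 0]
  have "distributed std_normal_distribution lborel ((*) \<sigma>) (normal_density 0 \<sigma>)"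
    using assms by simp
  from distributed_distr_eq_density[OF this] show ?thesis
    by (simp cong: distr_cong)
qed

text \<open>The standard central limit theorem divides by the standard deviation as well;
  multiplying by \<open>sqrt v\<close> afterwards restores a limit of variance
  \<open>v\<close>.\<close>

lemma (in prob_space) iid_central_limit:
  fixes D :: "nat \<Rightarrow> 'a \<Rightarrow> real"
  assumes indep: "indep_vars (\<lambda>_. borel) D UNIV"
    and mean: "\<And>n. expectation (D n) = 0"
    and sq: "\<And>n. integrable M (\<lambda>x. (D n x)\<^sup>2)"
    and var: "\<And>n. variance (D n) = v" and v: "0 < v"
    and distr: "\<And>n. distr M borel (D n) = \<mu>"
  shows "weak_conv_m (\<lambda>n. distr M borel (\<lambda>\<omega>. (\<Sum>i<n. D i \<omega>) / sqrt (real n))) (normal_distribution 0 v)"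
proof -
  have [measurable]: "D n \<in> borel_measurable M" for n
    using indep by (auto simp: indep_vars_def2)
  let ?Z = "\<lambda>n \<omega>. (\<Sum>i<n. D i \<omega>) / sqrt (real n * (sqrt v)\<^sup>2)"
  have "weak_conv_m (\<lambda>n. distr M borel (?Z n)) std_normal_distribution"
    using v by (intro central_limit_theorem_zero_mean[OF indep mean _ sq _ distr]) (auto simp: var)
  then have "weak_conv_m (\<lambda>n. distr (distr M borel (?Z n)) borel ((*) (sqrt v)))
      (distr std_normal_distribution borel ((*) (sqrt v)))"
    by (intro weak_conv_m_scale real_distribution_distr real_dist_normal_dist) auto
  moreover have "distr (distr M borel (?Z n)) borel ((*) (sqrt v)) = distr M borel (\<lambda>\<omega>. (\<Sum>i<n. D i \<omega>) / sqrt (real n))" for n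
    using v by (subst distr_distr) (auto simp: comp_def real_sqrt_mult intro!: distr_cong)
  ultimately show ?thesis
    using v by (simp add: distr_std_normal_scale normal_distribution_def)
qed

section \<open>A maximal inequality\<close>

text \<open>Packing a finite history into a list puts it in a countable type, where every function
  of the history is measurable.\<close>

lemma measurable_map_upt:
  fixes X :: "nat \<Rightarrow> 'a \<Rightarrow> 'b::countable"
  assumes X: "\<And>n. X n \<in> M \<rightarrow>\<^sub>M count_space UNIV"
  shows "(\<lambda>\<omega>. map (\<lambda>m. X m \<omega>) [0..<n]) \<in> M \<rightarrow>\<^sub>M count_space UNIV"
proof (rule measurable_count_space_eq2_countable[THEN iffD2], rule conjI, simp, rule ballI)
  fix l :: "'b list"
  show "(\<lambda>\<omega>. map (\<lambda>m. X m \<omega>) [0..<n]) -` {l} \<inter> space M \<in> sets M"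
  proof (cases "length l = n")
    case True
    then have "map (\<lambda>m. X m \<omega>) [0..<n] = l \<longleftrightarrow> (\<forall>m\<in>{..<n}. X m \<omega> = l ! m)" for \<omega>
      unfolding list_eq_iff_nth_eq[of "map _ _"] by auto
    then have "(\<lambda>\<omega>. map (\<lambda>m. X m \<omega>) [0..<n]) -` {l} \<inter> space M
        = {\<omega> \<in> space M. \<forall>m\<in>{..<n}. X m \<omega> = l ! m}"
      by auto
    also have "\<dots> \<in> sets M"
    proof (intro sets.sets_Collect_finite_All)
      fix m
      have "{\<omega> \<in> space M. X m \<omega> = l ! m} = X m -` {l ! m} \<inter> space M" by auto
      also have "\<dots> \<in> sets M" by (rule measurable_sets[OF X]) simp
      finally show "{\<omega> \<in> space M. X m \<omega> = l ! m} \<in> sets M" .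
    qed simp
    finally show ?thesis .
  next
    case False
    then have "(\<lambda>\<omega>. map (\<lambda>m. X m \<omega>) [0..<n]) -` {l} \<inter> space M = {}"
      by auto
    then show ?thesis by simp
  qed
qed

text \<open>
  The conditional expectations of \<open>Y\<close> given \<open>X 0, \<dots>, X (n - 1)\<close> form a martingale, and this is
  Doob's maximal inequality for it. The stopping time is encoded by the minimal histories on which
  the conditional expectation reaches \<open>c\<close>. The integral over \<open>H n \<omega>\<close> is not divided by
  \<open>prob (H n \<omega>)\<close>, which may be \<open>0\<close>.\<close>

lemma (in prob_space) maximal_inequality_cond_exp:
  fixes X :: "nat \<Rightarrow> 'a \<Rightarrow> 'b::countable" and Y :: "'a \<Rightarrow> real"
  assumes X[measurable]: "\<And>n. X n \<in> M \<rightarrow>\<^sub>M count_space UNIV"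
    and Y: "integrable M Y" "\<And>\<omega>. 0 \<le> Y \<omega>" and c: "0 \<le> c"
  defines "H \<equiv> (\<lambda>n \<omega>. {\<omega>' \<in> space M. \<forall>m<n. X m \<omega>' = X m \<omega>})"
  defines "B \<equiv> {\<omega> \<in> space M. \<exists>n. c * prob (H n \<omega>) \<le> (LINT \<omega>'|M. indicator (H n \<omega>) \<omega>' * Y \<omega>')}"
  shows "B \<in> sets M" and "c * prob B \<le> expectation Y"
proof -
  have [measurable]: "Y \<in> borel_measurable M" using Y by auto
  define hist where "hist n \<omega> = map (\<lambda>m. X m \<omega>) [0..<n]" for n \<omega>
  define E where "E l = {\<omega> \<in> space M. hist (length l) \<omega> = l}" for l
  have take_hist: "take j (hist n \<omega>) = hist j \<omega>" if "j \<le> n" for j n \<omega>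
    using that by (simp add: hist_def take_map min_def)
  have hist_eq: "hist n \<omega> = hist n \<omega>' \<longleftrightarrow> (\<forall>m<n. X m \<omega> = X m \<omega>')" for n \<omega> \<omega>'
    by (auto simp: hist_def)
  have len[simp]: "length (hist n \<omega>) = n" for n \<omega>
    by (simp add: hist_def)
  have H_E: "H n \<omega> = E (hist n \<omega>)" for n \<omega>
    by (auto simp: H_def E_def hist_eq)
  have E_sets[measurable]: "E l \<in> sets M" for l
  proof -
    have "E l = hist (length l) -` {l} \<inter> space M"
      by (auto simp: E_def)
    also have "\<dots> \<in> sets M"
      unfolding hist_def[abs_def] by (rule measurable_sets[OF measurable_map_upt[OF X]]) simp
    finally show ?thesis .
  qed
  \<comment> \<open>The integrals of \<open>Y\<close> over histories become values of a measure, so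
    countable additivity can be used on both sides of the inequality.\<close>
  define \<nu> where "\<nu> = density M (\<lambda>\<omega>. ennreal (Y \<omega>))"
  have \<nu>: "emeasure \<nu> (E l) = ennreal (LINT \<omega>'|M. indicator (E l) \<omega>' * Y \<omega>')" for l
  proof -
    have "emeasure \<nu> (E l) = (\<integral>\<^sup>+\<omega>. ennreal (indicator (E l) \<omega> * Y \<omega>) \<partial>M)"
      unfolding \<nu>_def by (subst emeasure_density)
        (auto intro!: nn_integral_cong simp: ennreal_mult' indicator_def)
    also have "\<dots> = ennreal (LINT \<omega>'|M. indicator (E l) \<omega>' * Y \<omega>')"
      using Y integrable_mult_indicator[OF E_sets Y(1), of l] by (intro nn_integral_eq_integral) auto
    finally show ?thesis .
  qed
  define good where "good l \<longleftrightarrow> c * prob (E l) \<le> (LINT \<omega>'|M. indicator (E l) \<omega>' * Y \<omega>')" for l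
  define T where "T = {l. good l \<and> (\<forall>j<length l. \<not> good (take j l))}"
  have B_eq: "B = (\<Union>l\<in>T. E l)"
  proof (intro set_eqI iffI)
    fix \<omega> assume "\<omega> \<in> B"
    then have \<omega>: "\<omega> \<in> space M" and ex: "\<exists>n. good (hist n \<omega>)"
      by (auto simp: B_def good_def H_E)
    define n where "n = (LEAST n. good (hist n \<omega>))"
    have "good (hist n \<omega>)"
      unfolding n_def using ex by (rule LeastI_ex)
    moreover have "\<not> good (take j (hist n \<omega>))" if "j < n" for j
      using not_less_Least[of j "\<lambda>n. good (hist n \<omega>)"] that by (simp add: take_hist n_def)
    ultimately have "hist n \<omega> \<in> T"
      by (auto simp: T_def)
    then show "\<omega> \<in> (\<Union>l\<in>T. E l)"
      using \<omega> by (intro UN_I[of "hist n \<omega>"]) (auto simp: E_def)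
  next
    fix \<omega> assume "\<omega> \<in> (\<Union>l\<in>T. E l)"
    then obtain l where "l \<in> T" "\<omega> \<in> E l"
      by blast
    then have "\<omega> \<in> space M" "good (hist (length l) \<omega>)"
      by (simp_all add: T_def E_def)
    then show "\<omega> \<in> B"
      by (auto simp: B_def good_def H_E)
  qed
  show B[measurable]: "B \<in> sets M"
    unfolding B_eq by (intro sets.countable_UN') auto
  have disj: "disjoint_family_on E T"
  proof (unfold disjoint_family_on_def, intro ballI impI)
    fix l l' assume l: "l \<in> T" "l' \<in> T" "l \<noteq> l'"
    \<comment> \<open>Two histories of the same \<open>\<omega>\<close> are prefixes of each other.
      If they differ, the shorter one is good and contradicts the minimality of the longer
      one.\<close>
    have sep: False if l: "l \<in> T" "l' \<in> T" "l \<noteq> l'" "length l \<le> length l'" "\<omega> \<in> E l" "\<omega> \<in> E l'" for l l' \<omega>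
    proof -
      have "l = take (length l) l'"
        using take_hist[of "length l" "length l'" \<omega>] that by (simp add: E_def)
      moreover from this have "length l < length l'"
        using that by (metis linorder_not_le nat_less_le take_all)
      ultimately show False
        using l(1,2) by (auto simp: T_def)
    qed
    from sep[of l l'] sep[of l' l] show "E l \<inter> E l' = {}"
      using l nat_le_linear[of "length l" "length l'"] by blast
  qed
  \<comment> \<open>On each minimal good history \<open>c * prob (E l)\<close> is at most
    \<open>\<nu>\<close> of it; the sum over the countable disjoint family \<open>T\<close> gives
    the bound.\<close>
  have "ennreal (c * prob B) = ennreal c * emeasure M B"
    using c by (simp add: emeasure_eq_measure ennreal_mult)
  also have "\<dots> = (\<integral>\<^sup>+l. ennreal c * emeasure M (E l) \<partial>count_space T)"
    unfolding B_eq using disj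
    by (subst emeasure_UN_countable) (auto simp: nn_integral_cmult)
  also have "\<dots> \<le> (\<integral>\<^sup>+l. emeasure \<nu> (E l) \<partial>count_space T)"
    using c by (intro nn_integral_mono)
      (auto simp: T_def good_def \<nu> emeasure_eq_measure ennreal_mult[symmetric] intro!: ennreal_leI)
  also have "\<dots> = emeasure \<nu> B"
    unfolding B_eq using disj by (subst emeasure_UN_countable) (auto simp: \<nu>_def)
  also have "\<dots> \<le> emeasure \<nu> (space M)"
    by (intro emeasure_mono) (use sets.sets_into_space[OF B] in \<open>simp_all add: \<nu>_def\<close>)
  also have "\<dots> = (\<integral>\<^sup>+\<omega>. ennreal (Y \<omega>) \<partial>M)"
    unfolding \<nu>_def by (subst emeasure_density) (auto intro!: nn_integral_cong)
  also have "\<dots> = ennreal (expectation Y)"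
    using Y by (intro nn_integral_eq_integral) auto
  finally show "c * prob B \<le> expectation Y"
    using Y by (simp add: integral_nonneg)
qed

text \<open>A point without a bound lies in \<open>B k\<close> for every natural \<open>k\<close>,
  and by the maximal inequality the intersection of these events has probability at most
  \<open>expectation Y / k\<close> for every positive \<open>k\<close>.\<close>

lemma (in prob_space) cond_exp_AE_bounded:
  fixes X :: "nat \<Rightarrow> 'a \<Rightarrow> 'b::countable" and Y :: "'a \<Rightarrow> real"
  assumes X[measurable]: "\<And>n. X n \<in> M \<rightarrow>\<^sub>M count_space UNIV"
    and Y: "integrable M Y" "\<And>\<omega>. 0 \<le> Y \<omega>"
  defines "H \<equiv> (\<lambda>n \<omega>. {\<omega>' \<in> space M. \<forall>m<n. X m \<omega>' = X m \<omega>})"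
  shows "AE \<omega> in M. \<exists>c\<ge>0. \<forall>n. (LINT \<omega>'|M. indicator (H n \<omega>) \<omega>' * Y \<omega>') \<le> c * prob (H n \<omega>)"
proof -
  define B where "B c = {\<omega> \<in> space M. \<exists>n. c * prob (H n \<omega>) \<le> (LINT \<omega>'|M. indicator (H n \<omega>) \<omega>' * Y \<omega>')}" for c
  have B: "B c \<in> sets M" if "0 \<le> c" for c
    unfolding B_def H_def by (rule maximal_inequality_cond_exp(1)[OF X Y that])
  have max: "c * prob (B c) \<le> expectation Y" if "0 \<le> c" for c
    unfolding B_def H_def by (rule maximal_inequality_cond_exp(2)[OF X Y that])
  define N where "N = (\<Inter>k::nat. B (real k))"
  have N: "N \<in> sets M"
    unfolding N_def using B by (intro sets.countable_INT') auto
  have "prob N \<le> e" if "e > 0" for e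
  proof -
    obtain k :: nat where k: "expectation Y / e < real k"
      using reals_Archimedean2 by blast
    have "0 \<le> expectation Y" using Y by (simp add: integral_nonneg)
    then have k0: "0 < real k" using k that
      by (meson divide_nonneg_pos le_less_trans)
    have "real k * prob N \<le> real k * prob (B (real k))"
      using B by (intro mult_left_mono finite_measure_mono) (auto simp: N_def)
    also have "\<dots> \<le> expectation Y"
      using max[of "real k"] by simp
    also have "\<dots> \<le> real k * e"
      using k that by (simp add: field_simps)
    finally show ?thesis
      using k0 by simp
  qed
  then have "prob N \<le> 0"
    using field_le_epsilon[of "prob N" 0] by force
  then have "N \<in> null_sets M"
    using N by (simp add: null_sets_def emeasure_eq_measure measure_le_0_iff)
  then have "AE \<omega> in M. \<omega> \<notin> N"
    by (rule AE_not_in)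
  then show ?thesis
  proof (rule AE_mp, intro AE_I2 impI)
    fix \<omega> assume "\<omega> \<in> space M" "\<omega> \<notin> N"
    then obtain k where "\<omega> \<notin> B (real k)"
      unfolding N_def by blast
    then show "\<exists>c\<ge>0. \<forall>n. (LINT \<omega>'|M. indicator (H n \<omega>) \<omega>' * Y \<omega>') \<le> c * prob (H n \<omega>)"
      using \<open>\<omega> \<in> space M\<close> by (intro exI[of _ "real k"]) (auto simp: B_def not_le less_imp_le)
  qed
qed

section \<open>The dyadic policy\<close>

abbreviation (input) fair_binomial :: "nat \<Rightarrow> nat pmf" where
  "fair_binomial k \<equiv> binomial_pmf k (1 / 2)"

lemma pmf_fair_binomial: "pmf (fair_binomial k) x = real (k choose x) / 2 ^ k"
proof (cases "x \<le> k")
  case True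
  then have "(1 / 2 :: real) ^ x * (1 / 2) ^ (k - x) = 1 / 2 ^ k"
    by (simp flip: power_add add: power_one_over)
  then show ?thesis
    by (simp add: mult.assoc)
qed (simp add: binomial_eq_0)

lemma answer_eq_card:
  fixes u :: "real ^ 'k"
  shows "answer f0 n u = card {i. u $ i \<in> dyadic_set f0 n}"
  by (simp add: answer_def indicator_def sum.If_cases)

lemma answer_le:
  fixes u :: "real ^ 'k"
  shows "answer f0 n u \<le> CARD('k)"
  unfolding answer_eq_card by (intro card_mono) auto

lemma answer_measurable [measurable]:
  assumes [measurable]: "f0 \<in> borel_measurable borel"
  shows "(answer f0 n :: real ^ 'k \<Rightarrow> nat) \<in> borel \<rightarrow>\<^sub>M count_space UNIV"
proof (rule measurable_count_space_eq2_countable[THEN iffD2], rule conjI, simp, rule ballI)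
  fix y :: nat
  have "(\<lambda>u :: real ^ 'k. \<Sum>i\<in>UNIV. indicator (dyadic_set f0 n) (u $ i) :: real) \<in> borel_measurable borel"
    by measurable
  also have "(\<lambda>u :: real ^ 'k. \<Sum>i\<in>UNIV. indicator (dyadic_set f0 n) (u $ i)) = (\<lambda>u. real (answer f0 n u))"
    by (simp add: answer_def indicator_def)
  finally have "(\<lambda>u :: real ^ 'k. real (answer f0 n u)) \<in> borel_measurable borel" .
  from measurable_sets[OF this, of "{real y}"]
  show "(answer f0 n :: real ^ 'k \<Rightarrow> nat) -` {y} \<inter> space borel \<in> sets borel"
    by (simp add: vimage_def)
qed

lemma consistent_set_measurable [measurable]:
  assumes [measurable]: "f0 \<in> borel_measurable borel"
  shows "(consistent_set f0 n x :: (real ^ 'k) set) \<in> sets borel"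
  unfolding consistent_set_def by measurable

section \<open>The setting and the joint law of the answers\<close>

locale dyadic_policy = prob_space P for P :: "'a measure" +
  fixes \<theta> :: "'a \<Rightarrow> real ^ 'k" and f0 :: "real \<Rightarrow> real"
  assumes f0_nonneg: "\<And>u. 0 \<le> f0 u"
    and indep: "indep_vars (\<lambda>_. borel) (\<lambda>i \<omega>. \<theta> \<omega> $ i) UNIV"
    and f0_density: "\<And>i. distributed P lborel (\<lambda>\<omega>. \<theta> \<omega> $ i) (\<lambda>u. ennreal (f0 u))"
begin

lemma f0_measurable [measurable]: "f0 \<in> borel_measurable borel"
proof -
  have "(\<lambda>u. ennreal (f0 u)) \<in> borel_measurable lborel"
    using distributed_borel_measurable[OF f0_density] .
  \<comment> \<open>A \<open>distributed\<close> fact only speaks of the \<open>ennreal\<close>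
    version of the density; by nonnegativity \<open>enn2real\<close> recovers
    \<open>f0\<close>.\<close>
  then have "(\<lambda>u. enn2real (ennreal (f0 u))) \<in> borel_measurable borel"
    by measurable
  then show ?thesis
    by (simp add: f0_nonneg)
qed

lemma \<theta>_measurable [measurable]: "\<theta> \<in> borel_measurable P"
proof (subst borel_measurable_euclidean_space, intro ballI)
  fix b :: "real ^ 'k" assume "b \<in> Basis"
  then obtain i where "b = axis i 1"
    by (auto simp: Basis_vec_def)
  moreover have "(\<lambda>\<omega>. \<theta> \<omega> $ i) \<in> borel_measurable P"
    using indep by (auto simp: indep_vars_def2)
  ultimately show "(\<lambda>\<omega>. \<theta> \<omega> \<bullet> b) \<in> borel_measurable P"
    by (simp add: inner_axis)
qed

text \<open>Exchanging the quantifiers turns the sets \<open>s m\<close> into one membership pattern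
  for each coordinate. Each pattern has probability \<open>1 / 2 ^ n\<close>, and the coordinates
  are independent.\<close>

lemma prob_dyadic_pattern:
  fixes s :: "nat \<Rightarrow> 'k set"
  shows "prob {\<omega> \<in> space P. \<forall>m\<in>{1..n}. {i. \<theta> \<omega> $ i \<in> dyadic_set f0 m} = s m} = (1 / 2 ^ n) ^ CARD('k)"
proof -
  let ?E = "\<lambda>i. {u. \<forall>m\<in>{1..n}. u \<in> dyadic_set f0 m \<longleftrightarrow> i \<in> s m}"
  have E[measurable]: "?E i \<in> sets borel" for i
    by measurable
  have single: "prob {\<omega> \<in> space P. \<theta> \<omega> $ i \<in> ?E i} = 1 / 2 ^ n" for i
  proof -
    have eq: "distr P lborel (\<lambda>\<omega>. \<theta> \<omega> $ i) = density lborel (\<lambda>u. ennreal (f0 u))"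
      using f0_density by (rule distributed_distr_eq_density)
    have \<mu>: "prob_space (density lborel (\<lambda>u. ennreal (f0 u)))"
      unfolding eq[symmetric] by (intro prob_space_distr distributed_measurable[OF f0_density])
    have "prob {\<omega> \<in> space P. \<theta> \<omega> $ i \<in> ?E i} = prob ((\<lambda>\<omega>. \<theta> \<omega> $ i) -` ?E i \<inter> space P)"
      by (intro arg_cong[of _ _ prob]) auto
    also have "\<dots> = measure (distr P lborel (\<lambda>\<omega>. \<theta> \<omega> $ i)) (?E i)"
      using E[of i] by (intro measure_distr[symmetric] distributed_measurable[OF f0_density]) simp
    also have "\<dots> = 1 / 2 ^ n"
      unfolding eq by (intro measure_dyadic_pattern \<mu>) simp
    finally show ?thesis .
  qed
  have "{\<omega> \<in> space P. \<forall>m\<in>{1..n}. {i. \<theta> \<omega> $ i \<in> dyadic_set f0 m} = s m}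
      = {\<omega> \<in> space P. \<forall>i. \<theta> \<omega> $ i \<in> ?E i}"
    by blast
  then show ?thesis
    by (simp only: prob_vec_rectangle[OF indep E] single) simp
qed

text \<open>The event splits according to which coordinates were counted at each question. All such
  choices are equally likely, and a product of binomial coefficients counts them.\<close>

lemma prob_answers:
  "prob {\<omega> \<in> space P. \<forall>m\<in>{1..n}. answer f0 m (\<theta> \<omega>) = x m}
    = (\<Prod>m\<in>{1..n}. pmf (fair_binomial CARD('k)) (x m))"
proof -
  let ?S = "\<lambda>r. {S :: 'k set. card S = r}"
  let ?P = "PiE {1..n} (\<lambda>m. ?S (x m))"
  let ?Z = "\<lambda>\<omega> m. {i. \<theta> \<omega> $ i \<in> dyadic_set f0 m}"
  let ?E = "\<lambda>s. {\<omega> \<in> space P. \<forall>m\<in>{1..n}. ?Z \<omega> m = s m}"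
  have fin: "finite ?P"
    by (intro finite_PiE) auto
  have disj: "disjoint_family_on ?E ?P"
  proof (unfold disjoint_family_on_def, intro ballI impI)
    fix s t assume st: "s \<in> ?P" "t \<in> ?P" "s \<noteq> t"
    then obtain m where "m \<in> {1..n}" "s m \<noteq> t m"
      using PiE_ext[of s _ _ t] by blast
    then show "?E s \<inter> ?E t = {}"
      by blast
  qed
  have meas: "?E s \<in> events" for s
  proof -
    let ?F = "\<lambda>i. {u. \<forall>m\<in>{1..n}. u \<in> dyadic_set f0 m \<longleftrightarrow> i \<in> s m}"
    have [measurable]: "?F i \<in> sets borel" for i
      by measurable
    have [measurable]: "(\<lambda>\<omega>. \<theta> \<omega> $ i) \<in> borel_measurable P" for i
      using indep by (auto simp: indep_vars_def2)
    have "?E s = {\<omega> \<in> space P. \<forall>i\<in>UNIV. \<theta> \<omega> $ i \<in> ?F i}"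
      by blast
    also have "\<dots> \<in> events"
      by (intro sets.sets_Collect_finite_All) (auto intro!: measurable_sets_Collect)
    finally show ?thesis .
  qed
  have "{\<omega> \<in> space P. \<forall>m\<in>{1..n}. answer f0 m (\<theta> \<omega>) = x m} = (\<Union>s\<in>?P. ?E s)" (is "?L = ?R")
  proof (intro set_eqI iffI)
    fix \<omega> assume "\<omega> \<in> ?L"
    then show "\<omega> \<in> ?R"
      by (intro UN_I[of "\<lambda>m\<in>{1..n}. ?Z \<omega> m"]) (auto simp: answer_eq_card)
  qed (auto simp: answer_eq_card PiE_iff)
  then have "prob ?L = (\<Sum>s\<in>?P. prob (?E s))"
    using fin disj meas by (simp only:, intro finite_measure_finite_Union) auto
  also have "\<dots> = real (card ?P) * (1 / 2 ^ n) ^ CARD('k)"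
    by (simp only: prob_dyadic_pattern sum_constant)
  also have "card ?P = (\<Prod>m\<in>{1..n}. CARD('k) choose x m)"
    using n_subsets[of "UNIV :: 'k set"] by (simp add: card_PiE)
  also have "real \<dots> * (1 / 2 ^ n) ^ CARD('k) = (\<Prod>m\<in>{1..n}. pmf (fair_binomial CARD('k)) (x m))"
    by (simp add: pmf_fair_binomial prod_dividef power_divide mult.commute flip: power_mult del: pmf_binomial)
  finally show ?thesis .
qed

text \<open>Shifted by one: questions are numbered from 1, while the limit theorems use sequences
  indexed from 0.\<close>

abbreviation X :: "nat \<Rightarrow> 'a \<Rightarrow> nat" where
  "X n \<omega> \<equiv> answer f0 (Suc n) (\<theta> \<omega>)"

lemma prob_prefix: "prob {\<omega> \<in> space P. \<forall>m<n. X m \<omega> = x m} = (\<Prod>m<n. pmf (fair_binomial CARD('k)) (x m))"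
proof -
  have "(\<forall>m\<in>{1..n}. answer f0 m (\<theta> \<omega>) = x (m - 1)) \<longleftrightarrow> (\<forall>m<n. X m \<omega> = x m)" for \<omega>
    unfolding image_Suc_lessThan[symmetric] by auto
  then have "prob {\<omega> \<in> space P. \<forall>m<n. X m \<omega> = x m}
      = (\<Prod>m\<in>{1..n}. pmf (fair_binomial CARD('k)) (x (m - 1)))"
    using prob_answers[of n "\<lambda>m. x (m - 1)"] by (simp only:)
  also have "\<dots> = (\<Prod>m<n. pmf (fair_binomial CARD('k)) (x m))"
    by (rule prod.reindex_bij_witness[of _ Suc "\<lambda>m. m - 1"]) auto
  finally show ?thesis .
qed

lemma X_measurable [measurable]: "X n \<in> P \<rightarrow>\<^sub>M count_space UNIV"
  by measurable

lemma X_range: "X n \<omega> \<in> set_pmf (fair_binomial CARD('k))"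
  by (simp add: answer_le)

lemma indep_X: "indep_vars (\<lambda>_. count_space UNIV) X UNIV"
  and distr_X: "distr P (count_space UNIV) (X n) = measure_pmf (fair_binomial CARD('k))"
proof -
  have fin: "finite (set_pmf (fair_binomial CARD('k)))"
    by (rule finite_set_pmf_binomial_pmf) simp
  note discrete = indep_vars_discreteI[of "fair_binomial CARD('k)" X, OF fin X_measurable X_range prob_prefix]
  show "indep_vars (\<lambda>_. count_space UNIV) X UNIV" "distr P (count_space UNIV) (X n) = measure_pmf (fair_binomial CARD('k))"
    by (rule discrete)+
qed

section \<open>Expectations under the prior and the entropy of the posterior\<close>

lemma abs_prior: "\<bar>prior f0 u\<bar> = prior f0 u"
  by (simp add: prior_nonneg f0_nonneg)

lemma distr_\<theta>: "distr P borel \<theta> = density lborel (\<lambda>u. ennreal (prior f0 u))"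
  using f0_nonneg indep f0_density by (intro distr_vec_eq_prior) auto

lemma expectation_\<theta>:
  fixes g :: "real ^ 'k \<Rightarrow> real"
  assumes [measurable]: "g \<in> borel_measurable borel"
  shows "expectation (\<lambda>\<omega>. g (\<theta> \<omega>)) = (LINT u|lborel. prior f0 u * g u)"
    and "integrable P (\<lambda>\<omega>. g (\<theta> \<omega>)) \<longleftrightarrow> integrable lborel (\<lambda>u. prior f0 u * g u)"
proof -
  have "expectation (\<lambda>\<omega>. g (\<theta> \<omega>)) = (LINT u|distr P borel \<theta>. g u)"
    by (simp add: integral_distr)
  then show "expectation (\<lambda>\<omega>. g (\<theta> \<omega>)) = (LINT u|lborel. prior f0 u * g u)"
    unfolding distr_\<theta> by (simp add: integral_density prior_nonneg f0_nonneg)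
  have "integrable P (\<lambda>\<omega>. g (\<theta> \<omega>)) \<longleftrightarrow> integrable (distr P borel \<theta>) g"
    by (simp add: integrable_distr_eq)
  then show "integrable P (\<lambda>\<omega>. g (\<theta> \<omega>)) \<longleftrightarrow> integrable lborel (\<lambda>u. prior f0 u * g u)"
    unfolding distr_\<theta> by (simp add: integrable_density prior_nonneg f0_nonneg)
qed

text \<open>This is the normalising constant of the posterior, as
  \<open>integral_prior_consistent_set\<close> shows; in product form its logarithm becomes a sum
  over the questions.\<close>

definition normalizer :: "nat \<Rightarrow> (nat \<Rightarrow> nat) \<Rightarrow> real" where
  "normalizer n x = (\<Prod>m\<in>{1..n}. pmf (fair_binomial CARD('k)) (x m))"

text \<open>Actual answers never exceed \<open>CARD('k)\<close>, so the entropy formula based on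
  this holds at every \<open>\<omega>\<close> and not merely almost surely.\<close>

lemma normalizer_pos:
  assumes "\<And>m. m \<in> {1..n} \<Longrightarrow> x m \<le> CARD('k)"
  shows "0 < normalizer n x"
  unfolding normalizer_def pmf_fair_binomial using assms by (intro prod_pos) auto

lemma prob_consistent_set: "prob {\<omega> \<in> space P. \<theta> \<omega> \<in> consistent_set f0 n x} = normalizer n x"
  using prob_answers[of n x] by (simp add: consistent_set_def normalizer_def)

lemma integral_prior_consistent_set:
  "(LINT u|lborel. indicator (consistent_set f0 n x) u * prior f0 (u :: real ^ 'k)) = normalizer n x"
proof -
  have "(LINT u|lborel. prior f0 u * indicator (consistent_set f0 n x) (u :: real ^ 'k))
      = expectation (\<lambda>\<omega>. indicator (consistent_set f0 n x) (\<theta> \<omega>))"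
    by (rule expectation_\<theta>(1)[symmetric]) measurable
  also have "\<dots> = expectation (indicator {\<omega> \<in> space P. \<theta> \<omega> \<in> consistent_set f0 n x})"
    by (intro Bochner_Integration.integral_cong) (auto simp: indicator_def)
  also have "\<dots> = normalizer n x"
    by (simp add: prob_consistent_set)
  finally show ?thesis
    by (simp add: mult.commute)
qed

text \<open>The conditional expectation of \<open>log 2 (prior f0 \<theta>)\<close> given the answers \<open>x\<close>.\<close>

definition remainder :: "nat \<Rightarrow> (nat \<Rightarrow> nat) \<Rightarrow> real" where
  "remainder n x = (LINT u|lborel. indicator (consistent_set f0 n x) u * (prior f0 u * log 2 (prior f0 (u :: real ^ 'k))))
    / normalizer n x"

text \<open>Where the posterior is positive, its logarithm is \<open>log 2 (prior f0 u)\<close>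
  minus that of the normalising constant. Integrating against the posterior separates the two
  terms.\<close>

lemma diff_entropy_posterior:
  assumes fin: "finite_diff_entropy (prior f0 :: real ^ 'k \<Rightarrow> real)"
    and x: "\<And>m. m \<in> {1..n} \<Longrightarrow> x m \<le> CARD('k)"
  shows "diff_entropy (posterior f0 n x :: real ^ 'k \<Rightarrow> real) = log 2 (normalizer n x) - remainder n x"
proof -
  let ?C = "consistent_set f0 n x :: (real ^ 'k) set"
  let ?c = "normalizer n x"
  have c: "0 < ?c"
    using x by (rule normalizer_pos)
  have int1: "integrable lborel (\<lambda>u. indicator ?C u * (prior f0 u * log 2 (prior f0 u)))"
    using integrable_mult_indicator[of ?C lborel "\<lambda>u. prior f0 u * log 2 (prior f0 u)"] fin
    by (simp add: finite_diff_entropy_def)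
  \<comment> \<open>A Bochner integral is 0 by default for a function that is not integrable, so the
    positive value of this one proves integrability.\<close>
  have int2: "integrable lborel (\<lambda>u. indicator ?C u * prior f0 u)"
    using integral_prior_consistent_set[of n x] c not_integrable_integral_eq by fastforce
  have post: "posterior f0 n x u = indicator ?C u * prior f0 u / ?c" for u
    unfolding posterior_def integral_prior_consistent_set ..
  \<comment> \<open>Where the posterior vanishes, every term carries a factor 0, whatever value the
    logarithm takes.\<close>
  have "posterior f0 n x u * log 2 (posterior f0 n x u) =
      indicator ?C u * (prior f0 u * log 2 (prior f0 u)) / ?c - log 2 ?c / ?c * (indicator ?C u * prior f0 u)" for u
  proof (cases "u \<in> ?C \<and> prior f0 u \<noteq> 0")
    case True
    then have "0 < prior f0 u"
      using prior_nonneg[of f0 u] f0_nonneg by auto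
    then show ?thesis
      using True c by (simp add: post log_divide field_simps)
  qed (auto simp: post)
  then have "diff_entropy (posterior f0 n x :: real ^ 'k \<Rightarrow> real) =
      - ((LINT u|lborel. indicator ?C u * (prior f0 u * log 2 (prior f0 u))) / ?c
        - log 2 ?c / ?c * (LINT u|lborel. indicator ?C u * prior f0 u))"
    using int1 int2 by (simp add: diff_entropy_def)
  then show ?thesis
    using c by (simp add: integral_prior_consistent_set remainder_def)
qed

text \<open>The absolute value of a conditional expectation is at most the conditional expectation
  of the absolute value. Multiplied by the probability of the history, this has the shape used in
  \<open>cond_exp_AE_bounded\<close>.\<close>

lemma remainder_bound:
  assumes fin: "finite_diff_entropy (prior f0 :: real ^ 'k \<Rightarrow> real)"
    and x: "\<And>m. m \<in> {1..n} \<Longrightarrow> x m \<le> CARD('k)"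
  shows "\<bar>remainder n x\<bar> * prob {\<omega> \<in> space P. \<theta> \<omega> \<in> consistent_set f0 n x} \<le>
    expectation (\<lambda>\<omega>. indicator {\<omega> \<in> space P. \<theta> \<omega> \<in> consistent_set f0 n x} \<omega> * \<bar>log 2 (prior f0 (\<theta> \<omega>))\<bar>)"
proof -
  let ?C = "consistent_set f0 n x :: (real ^ 'k) set"
  have c: "0 < normalizer n x"
    using x by (rule normalizer_pos)
  have "\<bar>remainder n x\<bar> * prob {\<omega> \<in> space P. \<theta> \<omega> \<in> ?C}
      = \<bar>LINT u|lborel. indicator ?C u * (prior f0 u * log 2 (prior f0 u))\<bar>"
    using c by (simp add: prob_consistent_set remainder_def abs_divide)
  also have "\<dots> \<le> (LINT u|lborel. \<bar>indicator ?C u * (prior f0 u * log 2 (prior f0 u))\<bar>)"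
    by (rule integral_abs_bound)
  also have "\<dots> = (LINT u|lborel. prior f0 u * (indicator ?C u * \<bar>log 2 (prior f0 u)\<bar>))"
    by (intro Bochner_Integration.integral_cong) (auto simp: abs_mult abs_prior indicator_def)
  also have "\<dots> = expectation (\<lambda>\<omega>. indicator ?C (\<theta> \<omega>) * \<bar>log 2 (prior f0 (\<theta> \<omega>))\<bar>)"
    by (rule expectation_\<theta>(1)[symmetric]) measurable
  also have "\<dots> = expectation (\<lambda>\<omega>. indicator {\<omega> \<in> space P. \<theta> \<omega> \<in> ?C} \<omega> * \<bar>log 2 (prior f0 (\<theta> \<omega>))\<bar>)"
    by (intro Bochner_Integration.integral_cong) (auto simp: indicator_def)
  finally show ?thesis .
qed

abbreviation R :: "nat \<Rightarrow> 'a \<Rightarrow> real" where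
  "R n \<omega> \<equiv> remainder n (\<lambda>m. answer f0 m (\<theta> \<omega>))"

lemma posterior_entropy_eq:
  assumes "finite_diff_entropy (prior f0 :: real ^ 'k \<Rightarrow> real)"
  shows "posterior_entropy f0 n (\<theta> \<omega>) = (\<Sum>m<n. log 2 (pmf (fair_binomial CARD('k)) (X m \<omega>))) - R n \<omega>"
proof -
  have pos: "pmf (fair_binomial CARD('k)) (answer f0 m (\<theta> \<omega>)) > 0" for m
    unfolding pmf_fair_binomial by (simp add: answer_le)
  have "posterior_entropy f0 n (\<theta> \<omega>) = log 2 (normalizer n (\<lambda>m. answer f0 m (\<theta> \<omega>))) - R n \<omega>"
    unfolding posterior_entropy_def using assms answer_le by (intro diff_entropy_posterior)
  also have "log 2 (normalizer n (\<lambda>m. answer f0 m (\<theta> \<omega>)))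
      = (\<Sum>m\<in>{1..n}. log 2 (pmf (fair_binomial CARD('k)) (answer f0 m (\<theta> \<omega>))))"
    unfolding normalizer_def log_def using pos by (subst ln_prod) (auto simp: sum_divide_distrib less_imp_neq[symmetric] simp del: pmf_binomial)
  also have "\<dots> = (\<Sum>m<n. log 2 (pmf (fair_binomial CARD('k)) (X m \<omega>)))"
    by (rule sum.reindex_bij_witness[of _ Suc "\<lambda>m. m - 1"]) auto
  finally show ?thesis .
qed

text \<open>Finite prior entropy makes
  \<open>\<bar>log 2 (prior f0 (\<theta> \<omega>))\<bar>\<close> integrable, and its conditional
  expectations given the answers dominate \<open>\<bar>R n \<omega>\<bar>\<close>.\<close>

lemma R_AE_bounded:
  assumes fin: "finite_diff_entropy (prior f0 :: real ^ 'k \<Rightarrow> real)"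
  shows "AE \<omega> in P. \<exists>c. \<forall>n. \<bar>R n \<omega>\<bar> \<le> c"
proof -
  let ?Y = "\<lambda>\<omega>. \<bar>log 2 (prior f0 (\<theta> \<omega>))\<bar>"
  let ?H = "\<lambda>n \<omega>. {\<omega>' \<in> space P. \<forall>m<n. X m \<omega>' = X m \<omega>}"
  have "integrable lborel (\<lambda>u. \<bar>prior f0 u * log 2 (prior f0 (u :: real ^ 'k))\<bar>)"
    using fin by (intro integrable_abs) (simp add: finite_diff_entropy_def)
  then have "integrable lborel (\<lambda>u. prior f0 u * \<bar>log 2 (prior f0 (u :: real ^ 'k))\<bar>)"
    by (simp add: abs_mult abs_prior)
  then have "integrable P ?Y"
    by (subst expectation_\<theta>(2)) auto
  then have "AE \<omega> in P. \<exists>c\<ge>0. \<forall>n. (LINT \<omega>'|P. indicator (?H n \<omega>) \<omega>' * ?Y \<omega>') \<le> c * prob (?H n \<omega>)"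
    by (intro cond_exp_AE_bounded X_measurable) auto
  then show ?thesis
  proof (rule AE_mp, intro AE_I2 impI)
    fix \<omega>
    assume "\<exists>c\<ge>0. \<forall>n. (LINT \<omega>'|P. indicator (?H n \<omega>) \<omega>' * ?Y \<omega>') \<le> c * prob (?H n \<omega>)"
    then obtain c where c: "\<And>n. (LINT \<omega>'|P. indicator (?H n \<omega>) \<omega>' * ?Y \<omega>') \<le> c * prob (?H n \<omega>)"
      by blast
    have "\<bar>R n \<omega>\<bar> \<le> c" for n
    proof -
      let ?x = "\<lambda>m. answer f0 m (\<theta> \<omega>)"
      have all: "(\<forall>m\<in>{1..n}. Q m) \<longleftrightarrow> (\<forall>m<n. Q (Suc m))" for Q
        unfolding image_Suc_lessThan[symmetric] by auto
      \<comment> \<open>Sharing the first \<open>n\<close> answers with \<open>\<omega>\<close> is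
        the same as being consistent with them, up to the index shift in \<open>X\<close>.\<close>
      have H: "?H n \<omega> = {\<omega>' \<in> space P. \<theta> \<omega>' \<in> consistent_set f0 n ?x}"
        unfolding consistent_set_def all by simp
      have "\<bar>R n \<omega>\<bar> * prob (?H n \<omega>) \<le> c * prob (?H n \<omega>)"
        using remainder_bound[OF fin, of n ?x] c[of n] unfolding H by (simp add: answer_le)
      moreover have "prob (?H n \<omega>) > 0"
        unfolding H prob_consistent_set using answer_le by (intro normalizer_pos)
      ultimately show ?thesis by simp
    qed
    then show "\<exists>c. \<forall>n. \<bar>R n \<omega>\<bar> \<le> c" by blast
  qed
qed

text \<open>The entropy depends on \<open>\<theta>\<close> only through the first \<open>n\<close>
  answers, a list in a countable type. In \<open>g\<close>, question \<open>m\<close> is found at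
  list position \<open>m - 1\<close>.\<close>

lemma posterior_entropy_measurable:
  "(\<lambda>\<omega>. posterior_entropy f0 n (\<theta> \<omega>)) \<in> borel_measurable P"
proof -
  define g where "g l = diff_entropy (posterior f0 n (\<lambda>m. l ! (m - 1)) :: real ^ 'k \<Rightarrow> real)" for l
  have "posterior_entropy f0 n (\<theta> \<omega>) = g (map (\<lambda>m. X m \<omega>) [0..<n])" for \<omega>
  proof -
    have "consistent_set f0 n (\<lambda>m. map (\<lambda>m. X m \<omega>) [0..<n] ! (m - 1))
        = (consistent_set f0 n (\<lambda>m. answer f0 m (\<theta> \<omega>)) :: (real ^ 'k) set)"
      unfolding consistent_set_def by (intro Collect_cong ball_cong) auto
    then show ?thesis
      by (simp add: g_def posterior_entropy_def posterior_def[abs_def])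
  qed
  moreover have "(\<lambda>\<omega>. g (map (\<lambda>m. X m \<omega>) [0..<n])) \<in> borel_measurable P"
    by (rule measurable_compose[OF measurable_map_upt[OF X_measurable]]) simp
  ultimately show ?thesis
    by simp
qed

section \<open>Limit theorems for the log-likelihood of the answers\<close>

lemma X_function:
  fixes g :: "nat \<Rightarrow> real"
  shows "expectation (\<lambda>\<omega>. g (X n \<omega>)) = measure_pmf.expectation (fair_binomial CARD('k)) g"
    and "integrable P (\<lambda>\<omega>. g (X n \<omega>))"
    and "distr P borel (\<lambda>\<omega>. g (X n \<omega>)) = distr (measure_pmf (fair_binomial CARD('k))) borel g"
    and "indep_vars (\<lambda>_. borel) (\<lambda>n \<omega>. g (X n \<omega>)) UNIV"
proof -
  have fin: "finite (set_pmf (fair_binomial CARD('k)))"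
    by (rule finite_set_pmf_binomial_pmf) simp
  show "expectation (\<lambda>\<omega>. g (X n \<omega>)) = measure_pmf.expectation (fair_binomial CARD('k)) g"
    unfolding distr_X[of n, symmetric] by (subst integral_distr) auto
  have "integrable (distr P (count_space UNIV) (X n)) g"
    unfolding distr_X by (rule integrable_measure_pmf_finite[OF fin])
  then show "integrable P (\<lambda>\<omega>. g (X n \<omega>))"
    by (subst (asm) integrable_distr_eq) auto
  show "distr P borel (\<lambda>\<omega>. g (X n \<omega>)) = distr (measure_pmf (fair_binomial CARD('k))) borel g"
    unfolding distr_X[of n, symmetric] by (subst distr_distr) (auto simp: comp_def)
  show "indep_vars (\<lambda>_. borel) (\<lambda>n \<omega>. g (X n \<omega>)) UNIV"
    using indep_X by (rule indep_vars_compose2) simp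
qed

abbreviation W :: "nat \<Rightarrow> 'a \<Rightarrow> real" where
  "W n \<omega> \<equiv> log 2 (pmf (fair_binomial CARD('k)) (X n \<omega>))"

lemma expectation_W: "expectation (W n) = - shannon_entropy (fair_binomial CARD('k))"
proof -
  have fin: "finite (set_pmf (fair_binomial CARD('k)))"
    by (rule finite_set_pmf_binomial_pmf) simp
  have "expectation (W n) = measure_pmf.expectation (fair_binomial CARD('k)) (\<lambda>x. log 2 (pmf (fair_binomial CARD('k)) x))"
    by (rule X_function(1))
  also have "\<dots> = - shannon_entropy (fair_binomial CARD('k))"
    unfolding shannon_entropy_def by (subst integral_measure_pmf[OF fin]) auto
  finally show ?thesis .
qed

text \<open>The constant is \<open>log 2 (2 ^ CARD('k))\<close>. Hence centring \<open>W n\<close>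
  is the same as centring the logarithm of the binomial coefficient, and the two have the same
  variance.\<close>

lemma W_eq: "W n \<omega> = log 2 (real (CARD('k) choose X n \<omega>)) - real CARD('k)"
  unfolding pmf_fair_binomial by (simp add: log_divide log_nat_power answer_le leD)

lemma entropy_eq_expectation_log_binomial:
  "shannon_entropy (fair_binomial CARD('k))
    = real CARD('k) - measure_pmf.expectation (fair_binomial CARD('k)) (\<lambda>x. log 2 (real (CARD('k) choose x)))"
proof -
  have "expectation (W 0) = expectation (\<lambda>\<omega>. log 2 (real (CARD('k) choose X 0 \<omega>))) - real CARD('k)"
    unfolding W_eq using X_function(2)[of "\<lambda>x. log 2 (real (CARD('k) choose x))" 0]
    by (simp add: prob_space)
  then show ?thesis
    unfolding expectation_W X_function(1)[of "\<lambda>x. log 2 (real (CARD('k) choose x))"] by simp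
qed

lemma log_likelihood_central_limit:
  defines "h \<equiv> shannon_entropy (fair_binomial CARD('k))"
    and "\<sigma>2 \<equiv> measure_pmf.variance (fair_binomial CARD('k)) (\<lambda>x. log 2 (real (CARD('k) choose x)))"
  shows "weak_conv_m (\<lambda>n. distr P borel (\<lambda>\<omega>. (\<Sum>i<n. W i \<omega> + h) / sqrt (real n))) (normal_distribution 0 \<sigma>2)"
proof -
  define f where "f x = log 2 (real (CARD('k) choose x))" for x
  define \<mu> where "\<mu> = measure_pmf.expectation (fair_binomial CARD('k)) f"
  have D: "W n \<omega> + h = f (X n \<omega>) - \<mu>" for n \<omega>
    unfolding W_eq h_def entropy_eq_expectation_log_binomial f_def \<mu>_def by simp
  have \<sigma>2: "\<sigma>2 = measure_pmf.expectation (fair_binomial CARD('k)) (\<lambda>x. (f x - \<mu>)\<^sup>2)"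
    by (simp add: \<sigma>2_def \<mu>_def f_def[abs_def])
  show ?thesis
  proof (cases "\<sigma>2 = 0")
    case True
    have fin: "finite (set_pmf (fair_binomial CARD('k)))"
      by (rule finite_set_pmf_binomial_pmf) simp
    \<comment> \<open>Zero variance does occur, for instance for \<open>CARD('k) = 1\<close>. A
      vanishing sum of squares with positive weights makes every centred summand 0, so each law in
      the sequence is already the point mass at 0.\<close>
    have "(\<Sum>x\<in>set_pmf (fair_binomial CARD('k)). pmf (fair_binomial CARD('k)) x * (f x - \<mu>)\<^sup>2) = 0"
      using True unfolding \<sigma>2 by (subst (asm) integral_measure_pmf[OF fin]) auto
    then have "pmf (fair_binomial CARD('k)) x * (f x - \<mu>)\<^sup>2 = 0" if "x \<in> set_pmf (fair_binomial CARD('k))" for x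
      using that by (subst (asm) sum_nonneg_eq_0_iff[OF fin]) (auto simp del: pmf_binomial set_pmf_binomial)
    then have "f (X n \<omega>) - \<mu> = 0" for n \<omega>
      using X_range[of n \<omega>] unfolding set_pmf_iff by fastforce
    then have "distr P borel (\<lambda>\<omega>. (\<Sum>i<n. W i \<omega> + h) / sqrt (real n)) = normal_distribution 0 \<sigma>2" for n
      unfolding D using True by (simp add: distr_const normal_distribution_def)
    then show ?thesis
      by (simp add: weak_conv_m_def weak_conv_def)
  next
    case False
    moreover have "0 \<le> \<sigma>2"
      unfolding \<sigma>2 by (rule Bochner_Integration.integral_nonneg) simp
    ultimately have "0 < \<sigma>2" by simp
    have mean: "expectation (\<lambda>\<omega>. f (X n \<omega>) - \<mu>) = 0" for n
      using X_function(1)[of f n] X_function(2)[of f n] by (simp add: prob_space \<mu>_def)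
    show ?thesis
      unfolding D
    proof (rule iid_central_limit)
      show "variance (\<lambda>\<omega>. f (X n \<omega>) - \<mu>) = \<sigma>2" for n
        unfolding mean \<sigma>2 using X_function(1)[of "\<lambda>x. (f x - \<mu>)\<^sup>2" n] by simp
      show "indep_vars (\<lambda>_. borel) (\<lambda>n \<omega>. f (X n \<omega>) - \<mu>) UNIV"
        by (rule X_function(4))
      show "integrable P (\<lambda>\<omega>. (f (X n \<omega>) - \<mu>)\<^sup>2)" for n
        by (rule X_function(2))
      show "distr P borel (\<lambda>\<omega>. f (X n \<omega>) - \<mu>) = distr (measure_pmf (fair_binomial CARD('k))) borel (\<lambda>x. f x - \<mu>)" for n
        by (rule X_function(3))
    qed fact+
  qed
qed

lemma log_likelihood_strong_law:
  "AE \<omega> in P. (\<lambda>n. (\<Sum>i<n. W i \<omega>) / real n) \<longlonglongrightarrow> - shannon_entropy (fair_binomial CARD('k))"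
proof (rule bounded_iid_average_AE)
  \<comment> \<open>Only finitely many answers are possible, so the sum of all absolute
    log-probabilities bounds each of them.\<close>
  let ?B = "\<Sum>x\<le>CARD('k). \<bar>log 2 (pmf (fair_binomial CARD('k)) x)\<bar>"
  show "indep_vars (\<lambda>_. borel) W UNIV"
    by (rule X_function(4))
  show "expectation (W n) = - shannon_entropy (fair_binomial CARD('k))" for n
    by (rule expectation_W)
  show "AE \<omega> in P. \<bar>W n \<omega>\<bar> \<le> ?B" for n
    using answer_le by (intro AE_I2 member_le_sum) (auto simp del: pmf_binomial)
qed

end

theorem theorem5:
  fixes P :: "'a measure"
    and \<theta> :: "'a \<Rightarrow> real ^ 'k"
    and f0 :: "real \<Rightarrow> real"
    and M :: real
  defines "h \<equiv> shannon_entropy (binomial_pmf CARD('k) (1 / 2))"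
    and "\<sigma>2 \<equiv> measure_pmf.variance (binomial_pmf CARD('k) (1 / 2))
                (\<lambda>x. log 2 (real (CARD('k) choose x)))"
  assumes "prob_space P"
    and "\<And>u. 0 \<le> f0 u"
    and "prob_space.indep_vars P (\<lambda>_. borel) (\<lambda>i \<omega>. \<theta> \<omega> $ i) UNIV"
    and "\<And>i. distributed P lborel (\<lambda>\<omega>. \<theta> \<omega> $ i) (\<lambda>u. ennreal (f0 u))"
    and "finite_diff_entropy (prior f0 :: real ^ 'k \<Rightarrow> real)"
    and "M > 0"
    and "\<And>u. f0 u \<le> M"
  shows "(AE \<omega> in P. (\<lambda>N. posterior_entropy f0 N (\<theta> \<omega>) / real N) \<longlonglongrightarrow> - h) \<and>
         weak_conv_m
           (\<lambda>N. distr P borel (\<lambda>\<omega>. (posterior_entropy f0 N (\<theta> \<omega>) + real N * h) / sqrt (real N)))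
           (normal_distribution 0 \<sigma>2)"
proof -
  interpret dyadic_policy P \<theta> f0
    using assms(3-6) by (intro dyadic_policy.intro dyadic_policy_axioms.intro)
  note fin = assms(7)
  note H = posterior_entropy_eq[OF fin]
  \<comment> \<open>A bounded sequence divided by any scale tending to infinity vanishes; this is
    applied with scales \<open>n\<close> and \<open>sqrt n\<close>.\<close>
  have null: "AE \<omega> in P. (\<lambda>n. R n \<omega> / a n) \<longlonglongrightarrow> 0" if a: "filterlim a at_top sequentially" for a :: "nat \<Rightarrow> real"
    using R_AE_bounded[OF fin]
  proof eventually_elim
    case (elim \<omega>)
    then obtain c where c: "\<And>n. \<bar>R n \<omega>\<bar> \<le> c" by blast
    show ?case
    proof (rule Lim_null_comparison)
      show "\<forall>\<^sub>F n in sequentially. norm (R n \<omega> / a n) \<le> c / a n"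
        using filterlim_at_top_dense[THEN iffD1, OF a, rule_format, of 0]
        by eventually_elim (use c in \<open>auto simp: abs_divide intro: divide_right_mono\<close>)
      show "(\<lambda>n. c / a n) \<longlonglongrightarrow> 0"
        using a by (intro tendsto_divide_0[OF tendsto_const] filterlim_at_top_imp_at_infinity)
    qed
  qed
  have "AE \<omega> in P. (\<lambda>N. posterior_entropy f0 N (\<theta> \<omega>) / real N) \<longlonglongrightarrow> - h"
    using log_likelihood_strong_law null[OF filterlim_real_sequentially]
  proof eventually_elim
    case (elim \<omega>)
    from tendsto_diff[OF this] show ?case
      by (simp add: H h_def diff_divide_distrib)
  qed
  moreover have "weak_conv_m
      (\<lambda>N. distr P borel (\<lambda>\<omega>. (posterior_entropy f0 N (\<theta> \<omega>) + real N * h) / sqrt (real N)))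
      (normal_distribution 0 \<sigma>2)"
  proof -
    have [measurable]: "W n \<in> borel_measurable P" for n
      using X_function(4) by (auto simp: indep_vars_def2)
    \<comment> \<open>Measurability of the remainder is read off from the entropy formula, both
      other terms of which are measurable.\<close>
    have [measurable]: "R n \<in> borel_measurable P" for n
    proof -
      have "R n \<omega> = (\<Sum>m<n. W m \<omega>) - posterior_entropy f0 n (\<theta> \<omega>)" for \<omega>
        by (simp add: H)
      then show ?thesis
        using posterior_entropy_measurable[of n] by simp
    qed
    have lim: "filterlim (\<lambda>n. sqrt (real n)) at_top sequentially"
      by (rule filterlim_compose[OF sqrt_at_top filterlim_real_sequentially])
    have "real_distribution (normal_distribution 0 \<sigma>2)"
    proof (cases "\<sigma>2 = 0")
      case True
      then show ?thesis
        by (simp add: normal_distribution_def real_distribution_def real_distribution_axioms_def prob_space_return)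
    next
      case False
      moreover have "0 \<le> \<sigma>2"
        unfolding \<sigma>2_def by (rule Bochner_Integration.integral_nonneg) simp
      ultimately show ?thesis
        by (simp add: normal_distribution_def real_distribution_def real_distribution_axioms_def prob_space_normal_density)
    qed
    then have "weak_conv_m
      (\<lambda>n. distr P borel (\<lambda>\<omega>. (\<Sum>i<n. W i \<omega> + h) / sqrt (real n) + - (R n \<omega> / sqrt (real n))))
      (normal_distribution 0 \<sigma>2)"
      using log_likelihood_central_limit null[OF lim] unfolding h_def \<sigma>2_def
      by (intro weak_conv_add_AE_null) (auto elim!: eventually_mono intro: tendsto_minus_cancel_left[THEN iffD1])
    \<comment> \<open>The centring \<open>real n * h\<close> is distributed over the
      \<open>n\<close> summands, and the remainder becomes the almost surely vanishing perturbation
      in Slutsky's theorem.\<close>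
    moreover have "(posterior_entropy f0 n (\<theta> \<omega>) + real n * h) / sqrt (real n)
        = (\<Sum>i<n. W i \<omega> + h) / sqrt (real n) + - (R n \<omega> / sqrt (real n))" for n \<omega>
      by (simp add: H sum.distrib flip: add_divide_distrib diff_divide_distrib)
    ultimately show ?thesis
      by simp
  qed
  ultimately show ?thesis ..
qed

end
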